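(* Let $T>0$, $n=\lfloor m(T+1)\rfloor$, $\alpha\in(0,1/2)$, and let $p\ge 1$ be a fixed integer. Let $\mathbb{D}_m$ be the detector function, $\mathbb{D}_m^{[b]}$, $b\in\mathbb{N}$, its bootstrap replicates computed from the learning sample, $I_1,\dots,I_p$ the monitoring sub-intervals of $[1,T+1]$, $g_{1,m}^B,\dots,g_{p,m}^B$ the bootstrap-based thresholds and $\tau_m^B$ the resulting piecewise constant threshold function, all as defined in the context. Assume that, under $H_0$, $$(\mathbb{D}_m,\mathbb{D}_m^{[1]},\mathbb{D}_m^{[2]})\leadsto(\mathbb{D}_F,\mathbb{D}_F^{[1]},\mathbb{D}_F^{[2]})\quad\text{in }\{\ell^\infty([1,T+1])\}^3\text{ as }m\to\infty,$$ where $\mathbb{D}_F$ is the weak limit of $\mathbb{D}_m$ and $\mathbb{D}_F^{[1]}$ and $\mathbb{D}_F^{[2]}$ are independent copies of $\mathbb{D}_F$. Assume furthermore that the random vector $\big(\sup_{t\in I_1}\mathbb{D}_F(t),\dots,\sup_{t\in I_p}\mathbb{D}_F(t)\big)$ has a continuous distribution function. Then, under $H_0$, as $m,B\to\infty$, $$\Pr\Big\{\sup_{t\in I_1}\mathbb{D}_m(t)\le g_{1,m}^B\Big\}\to(1-\alpha)^{1/p},$$ and, for any $i\in\{2,\dots,p\}$, $$\Pr\Big\{\sup_{t\in I_i}\mathbb{D}_m(t)\le g_{i,m}^B\;\Big|\;\sup_{t\in I_1}\mathbb{D}_m(t)\le g_{1,m}^B,\dots,\sup_{t\in I_{i-1}}\mathbb{D}_m(t)\le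 g_{i-1,m}^B\Big\}\to(1-\alpha)^{1/p}.$$ As a consequence, on the one hand, under $H_0$, $\Pr(\mathbb{D}_m\le\tau_m^B)\to1-\alpha$ as $m,B\to\infty$ and, on the other hand, when $\sup_{t\in[1,T+1]}\mathbb{D}_m(t)\to\infty$ in probability as $m\to\infty$, $$\Pr\{\exists\,t\in[1,T+1]\text{ such that }\mathbb{D}_m(t)>\tau_m^B(t)\}\to1\quad\text{as }m,B\to\infty.$$
   Context: Setting. For each $m\ge1$, $\mathbf X_1,\dots,\mathbf X_m$ are $d$-dimensional continuous random vectors (the learning sample), and $\mathbf X_{m+1},\dots,\mathbf X_n$, $n=\lfloor m(T+1)\rfloor$, are observations that arrive sequentially. The null hypothesis $H_0$ is: $\mathbf X_1,\dots,\mathbf X_n$ is a stretch from a stationary time series with contemporary distribution function (d.f.) $F$, that is, $F(\mathbf x)=\Pr(\mathbf X_1\le\mathbf x)$. The learning sample is always known to satisfy $H_0$: in the last claim of the theorem (where $H_0$ need not hold for $\mathbf X_{m+1},\dots,\mathbf X_n$), the law of $(\mathbf X_1,\dots,\mathbf X_m)$ is the same as under $H_0$. Detector function. $D_m(k)$, $k\in\{m+1,\dots,n\}$, are arbitrary nonnegative statistics (detectors), $D_m(k)$ being computed from $\mathbf X_1,\dots,\mathbf X_k$; by convention $D_m(m)=0$. The detector function is $\mathbb{D}_m(t)=D_m(\lfloor mt\rfloor)$, $t\in[1,T+1]$. Bootstrap replicates. $\mathbb{D}_m^{[b]}$, $b\in\mathbb{N}$, are random elements of $\ell^\infty([1,T+1])$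 of the form $\mathbb{D}_m^{[b]}=\Phi_m(\mathbf X_1,\dots,\mathbf X_m,\mathbf W_m^{[b]})$, where the $\mathbf W_m^{[b]}$, $b\in\mathbb{N}$ (the additional sources of randomness of the resampling scheme), are independent and identically distributed and independent of the observations, and $\Phi_m$ does not depend on $b$. Grid. $1=t_0<t_1<\dots<t_p=T+1$ is the uniformly spaced grid $t_i=1+iT/p$ (with $m$ large enough that $T/p>1/m$); $I_i=[t_{i-1},t_i)$ for $i\in\{1,\dots,p-1\}$ and $I_p=[t_{p-1},t_p]$. Thresholds. For a univariate d.f. $G$, $G^{-1}(y)=\inf\{x\in\mathbb{R}:G(x)\ge y\}$, $y\in[0,1]$, with $\inf\emptyset=\infty$. Recursively, $g_{j,m}^B=F_{\mathbb{D}_m,j}^{B,-1}\{(1-\alpha)^{1/p}\}$, $j\in\{1,\dots,p\}$, where $F_{\mathbb{D}_m,j}^{B,-1}$ is the quantile function associated with $F_{\mathbb{D}_m,j}^{B}$, $F_{\mathbb{D}_m,1}^B$ is the empirical d.f. of $\sup_{t\in I_1}\mathbb{D}_m^{[1]}(t),\dots,\sup_{t\in I_1}\mathbb{D}_m^{[B]}(t)$ and, for $j\in\{2,\dots,p\}$ and $x\in\mathbb{R}$, $$F_{\mathbb{D}_m,j}^B(x)=\frac{\sum_{b=1}^B\mathbf 1\{\sup_{t\in I_j}\mathbb{D}_m^{[b]}(t)\le x,\ \sup_{t\in I_1}\mathbb{D}_m^{[b]}(t)\le g_{1,m}^B,\dots,\sup_{t\in I_{j-1}}\mathbb{D}_m^{[b]}(t)\le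 g_{j-1,m}^B\}}{\sum_{b=1}^B\mathbf 1\{\sup_{t\in I_1}\mathbb{D}_m^{[b]}(t)\le g_{1,m}^B,\dots,\sup_{t\in I_{j-1}}\mathbb{D}_m^{[b]}(t)\le g_{j-1,m}^B\}}.$$ $\tau_m^B$ is the function on $[1,T+1]$ equal to $g_{i,m}^B$ on $I_i$, $i\in\{1,\dots,p\}$. The event $\{\mathbb{D}_m\le\tau_m^B\}$ means $\mathbb{D}_m(t)\le\tau_m^B(t)$ for all $t\in[1,T+1]$. Conventions. $\ell^\infty(S)$ is the space of bounded real-valued functions on $S$ with the uniform metric; $\leadsto$ denotes weak convergence in the sense of Hoffmann-Jørgensen (van der Vaart and Wellner, Definition 1.3.3). "Independent copies" means that $\mathbb{D}_F,\mathbb{D}_F^{[1]},\mathbb{D}_F^{[2]}$ are mutually independent and identically distributed. Limits as $m,B\to\infty$ are joint limits. *)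

theory Defs
  imports "HOL-Probability.Probability"
begin

section \<open>Weak convergence in the sense of Hoffmann-Jorgensen\<close>

text \<open>
  The elements of \<open>linf S\<close> are bounded and extensional, i.e. they take the value
  \<^const>\<open>undefined\<close> outside \<open>S\<close>.
\<close>

definition linf :: "'t set \<Rightarrow> ('t \<Rightarrow> real) metric" where
  "linf S = funspace S euclidean_metric"

definition borel_of :: "'x topology \<Rightarrow> 'x measure" where
  "borel_of \<T> = sigma (topspace \<T>) {U. openin \<T> U}"

text \<open>
  Outer expectation of an arbitrary bounded function. The infimum is usually taken over measurable
  extended-real majorants whose expectation exists; when \<open>h\<close> is bounded, majorants with infinite
  expectation do not affect the infimum and the other ones are almost surely finite, so that real
  integrable majorants suffice.
\<close>

definition outer_expectation :: "'a measure \<Rightarrow> ('a \<Rightarrow> real) \<Rightarrow> real" where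
  "outer_expectation M h =
     Inf {integral\<^sup>L M U |U. integrable M U \<and> (\<forall>\<omega>\<in>space M. h \<omega> \<le> U \<omega>)}"

text \<open>
  The maps \<open>V m\<close> are arbitrary (not necessarily measurable) maps with values in the space
  \<open>\<T>\<close>; only the limit has to be Borel measurable.
\<close>

definition weakly_converges ::
  "'x topology \<Rightarrow> (nat \<Rightarrow> 'a measure) \<Rightarrow> (nat \<Rightarrow> 'a \<Rightarrow> 'x) \<Rightarrow> 'c measure \<Rightarrow> ('c \<Rightarrow> 'x) \<Rightarrow> bool" where
  "weakly_converges \<T> M V L Y \<longleftrightarrow>
     Y \<in> L \<rightarrow>\<^sub>M borel_of \<T> \<and>
     (\<forall>h. continuous_map \<T> euclideanreal h \<and> bounded (h ` topspace \<T>) \<longrightarrow>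
        (\<lambda>m. outer_expectation (M m) (\<lambda>\<omega>. h (V m \<omega>))) \<longlonglongrightarrow> integral\<^sup>L L (\<lambda>\<omega>. h (Y \<omega>)))"

section \<open>Observations\<close>

definition horizon :: "real \<Rightarrow> nat \<Rightarrow> nat" where
  "horizon T m = nat \<lfloor>real m * (T + 1)\<rfloor>"

definition stretch_law ::
  "'a measure \<Rightarrow> (nat \<Rightarrow> 'a \<Rightarrow> 'v::topological_space) \<Rightarrow> nat \<Rightarrow> (nat \<Rightarrow> 'v) measure" where
  "stretch_law M X k = distr M (Pi\<^sub>M {1..k} (\<lambda>_. borel)) (\<lambda>\<omega>. \<lambda>i\<in>{1..k}. X i \<omega>)"

definition stationary_series :: "'s measure \<Rightarrow> (nat \<Rightarrow> 's \<Rightarrow> 'v::topological_space) \<Rightarrow> bool" where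
  "stationary_series S Z \<longleftrightarrow>
     prob_space S \<and> (\<forall>i. Z i \<in> borel_measurable S) \<and>
     (\<forall>J h. finite J \<longrightarrow>
        distr S (Pi\<^sub>M J (\<lambda>_. borel)) (\<lambda>\<omega>. \<lambda>i\<in>J. Z (i + h) \<omega>) =
        distr S (Pi\<^sub>M J (\<lambda>_. borel)) (\<lambda>\<omega>. \<lambda>i\<in>J. Z i \<omega>))"

text \<open>
  The law \<open>R m\<close> of the additional sources of randomness \<open>W m b\<close>, \<open>b \<ge> 1\<close>, is part of the
  resampling scheme and hence the same whatever the law of the observations, which is left
  unspecified here. For each \<open>m\<close>, everything may live on a different probability space.
\<close>

definition sampling_model ::
  "real \<Rightarrow> (nat \<Rightarrow> 'w measure) \<Rightarrow> (nat \<Rightarrow> 'a measure) \<Rightarrow>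
   (nat \<Rightarrow> nat \<Rightarrow> 'a \<Rightarrow> 'v::topological_space) \<Rightarrow> (nat \<Rightarrow> nat \<Rightarrow> 'a \<Rightarrow> 'w) \<Rightarrow> bool" where
  "sampling_model T R M X W \<longleftrightarrow>
     (\<forall>m\<ge>1. prob_space (M m) \<and>
        (\<forall>i\<in>{1..horizon T m}. X m i \<in> borel_measurable (M m)) \<and>
        prob_space.indep_vars (M m) (\<lambda>_. R m) (W m) {1..} \<and>
        (\<forall>b\<ge>1. distr (M m) (R m) (W m b) = R m) \<and>
        prob_space.indep_set (M m)
          {(\<lambda>\<omega>. \<lambda>i\<in>{1..horizon T m}. X m i \<omega>) -` A \<inter> space (M m) |A.
             A \<in> sets (Pi\<^sub>M {1..horizon T m} (\<lambda>_. borel))}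
          {(\<lambda>\<omega>. \<lambda>b\<in>{1..}. W m b \<omega>) -` A \<inter> space (M m) |A.
             A \<in> sets (Pi\<^sub>M {1..} (\<lambda>_. R m))})"

section \<open>Detector function and bootstrap replicates\<close>

definition detector_statistics ::
  "real \<Rightarrow> (nat \<Rightarrow> nat \<Rightarrow> (nat \<Rightarrow> 'v::topological_space) \<Rightarrow> real) \<Rightarrow> bool" where
  "detector_statistics T \<delta> \<longleftrightarrow>
     (\<forall>m\<ge>1. \<forall>k\<in>{m + 1..horizon T m}.
        \<delta> m k \<in> borel_measurable (Pi\<^sub>M {1..k} (\<lambda>_. borel)) \<and>
        (\<forall>x\<in>space (Pi\<^sub>M {1..k} (\<lambda>_. borel)). 0 \<le> \<delta> m k x))"

definition detector_fun ::
  "real \<Rightarrow> (nat \<Rightarrow> nat \<Rightarrow> (nat \<Rightarrow> 'v) \<Rightarrow> real) \<Rightarrow> nat \<Rightarrow> (nat \<Rightarrow> 'v) \<Rightarrow> real \<Rightarrow> real" where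
  "detector_fun T \<delta> m x =
     (\<lambda>t\<in>{1..T + 1}. let k = nat \<lfloor>real m * t\<rfloor>
        in if k = m then 0 else \<delta> m k (restrict x {1..k}))"

definition grid :: "real \<Rightarrow> nat \<Rightarrow> nat \<Rightarrow> real" where
  "grid T p i = 1 + real i * T / real p"

definition sub_interval :: "real \<Rightarrow> nat \<Rightarrow> nat \<Rightarrow> real set" where
  "sub_interval T p i =
     (if i = p then {grid T p (i - 1)..grid T p i} else {grid T p (i - 1)..<grid T p i})"

definition sup_on :: "real \<Rightarrow> nat \<Rightarrow> nat \<Rightarrow> (real \<Rightarrow> real) \<Rightarrow> real" where
  "sup_on T p i f = (SUP t\<in>sub_interval T p i. f t)"

text \<open>
  The measurability requirement is implied by Borel measurability of \<open>\<Phi> m\<close> as a map into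
  \<open>linf {1..T + 1}\<close>; it is what makes the thresholds below random variables.
\<close>

definition replicate_map ::
  "real \<Rightarrow> nat \<Rightarrow> (nat \<Rightarrow> 'w measure) \<Rightarrow>
   (nat \<Rightarrow> (nat \<Rightarrow> 'v::topological_space) \<Rightarrow> 'w \<Rightarrow> real \<Rightarrow> real) \<Rightarrow> bool" where
  "replicate_map T p R \<Phi> \<longleftrightarrow>
     (\<forall>m\<ge>1.
        (\<forall>x\<in>space (Pi\<^sub>M {1..m} (\<lambda>_. borel)). \<forall>w\<in>space (R m).
           \<Phi> m x w \<in> mspace (linf {1..T + 1})) \<and>
        (\<forall>j\<in>{1..p}. (\<lambda>(x, w). sup_on T p j (\<Phi> m x w))
           \<in> borel_measurable (Pi\<^sub>M {1..m} (\<lambda>_. borel) \<Otimes>\<^sub>M R m)))"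

definition replicate_fun ::
  "(nat \<Rightarrow> (nat \<Rightarrow> 'v) \<Rightarrow> 'w \<Rightarrow> real \<Rightarrow> real) \<Rightarrow> nat \<Rightarrow> (nat \<Rightarrow> 'v) \<Rightarrow> 'w \<Rightarrow> real \<Rightarrow> real" where
  "replicate_fun \<Phi> m x w = \<Phi> m (restrict x {1..m}) w"

section \<open>Thresholds\<close>

text \<open>The value is extended real so that the infimum of the empty set is \<open>\<infinity>\<close>.\<close>

definition quantile :: "(real \<Rightarrow> real) \<Rightarrow> real \<Rightarrow> ereal" where
  "quantile H y = Inf (ereal ` {x. y \<le> H x})"

text \<open>
  Here \<open>s b i\<close> is the supremum of the \<open>b\<close>-th replicate over the \<open>i\<close>-th sub-interval. For \<open>j = 1\<close>
  the conditioning is void and this is the empirical distribution function of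
  \<open>s 1 1, \<dots>, s B 1\<close>.
\<close>

definition cond_edf ::
  "(nat \<Rightarrow> nat \<Rightarrow> real) \<Rightarrow> nat \<Rightarrow> (nat \<Rightarrow> ereal) \<Rightarrow> nat \<Rightarrow> real \<Rightarrow> real" where
  "cond_edf s B g j x =
     (\<Sum>b=1..B. of_bool (s b j \<le> x \<and> (\<forall>i\<in>{1..<j}. ereal (s b i) \<le> g i))) /
     (\<Sum>b=1..B. of_bool (\<forall>i\<in>{1..<j}. ereal (s b i) \<le> g i))"

lemma cond_edf_cong [fundef_cong]:
  assumes "s = s'" "B = B'" "j = j'" "\<And>i. i \<in> {1..<j'} \<Longrightarrow> g i = g' i"
  shows "cond_edf s B g j = cond_edf s' B' g' j'"
  using assms by (simp add: cond_edf_def fun_eq_iff)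

function threshold_seq :: "(nat \<Rightarrow> nat \<Rightarrow> real) \<Rightarrow> nat \<Rightarrow> real \<Rightarrow> nat \<Rightarrow> ereal" where
  "threshold_seq s B y j = quantile (cond_edf s B (\<lambda>i. threshold_seq s B y i) j) y"
  by pat_completeness auto
termination
  by (relation "Wellfounded.measure (\<lambda>(s, B, y, j). j)") auto

declare threshold_seq.simps [simp del]

text \<open>Threshold \<open>j\<close> as a function of the observations \<open>x\<close> and the sources of randomness \<open>w\<close>.\<close>

definition threshold ::
  "real \<Rightarrow> nat \<Rightarrow> real \<Rightarrow> (nat \<Rightarrow> (nat \<Rightarrow> 'v) \<Rightarrow> 'w \<Rightarrow> real \<Rightarrow> real) \<Rightarrow> nat \<Rightarrow> nat \<Rightarrow>
   (nat \<Rightarrow> 'v) \<Rightarrow> (nat \<Rightarrow> 'w) \<Rightarrow> nat \<Rightarrow> ereal" where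
  "threshold T p \<alpha> \<Phi> m B x w =
     threshold_seq (\<lambda>b i. sup_on T p i (replicate_fun \<Phi> m x (w b))) B ((1 - \<alpha>) powr (1 / real p))"

definition threshold_fun ::
  "real \<Rightarrow> nat \<Rightarrow> real \<Rightarrow> (nat \<Rightarrow> (nat \<Rightarrow> 'v) \<Rightarrow> 'w \<Rightarrow> real \<Rightarrow> real) \<Rightarrow> nat \<Rightarrow> nat \<Rightarrow>
   (nat \<Rightarrow> 'v) \<Rightarrow> (nat \<Rightarrow> 'w) \<Rightarrow> real \<Rightarrow> ereal" where
  "threshold_fun T p \<alpha> \<Phi> m B x w =
     (\<lambda>t\<in>{1..T + 1}. threshold T p \<alpha> \<Phi> m B x w (THE i. i \<in> {1..p} \<and> t \<in> sub_interval T p i))"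

text \<open>No exceedance in the \<open>i\<close>-th sub-interval.\<close>

definition below_threshold ::
  "real \<Rightarrow> nat \<Rightarrow> real \<Rightarrow> (nat \<Rightarrow> nat \<Rightarrow> (nat \<Rightarrow> 'v) \<Rightarrow> real) \<Rightarrow>
   (nat \<Rightarrow> (nat \<Rightarrow> 'v) \<Rightarrow> 'w \<Rightarrow> real \<Rightarrow> real) \<Rightarrow> nat \<Rightarrow> nat \<Rightarrow>
   (nat \<Rightarrow> 'v) \<Rightarrow> (nat \<Rightarrow> 'w) \<Rightarrow> nat \<Rightarrow> bool" where
  "below_threshold T p \<alpha> \<delta> \<Phi> m B x w i \<longleftrightarrow>
     ereal (sup_on T p i (detector_fun T \<delta> m x)) \<le> threshold T p \<alpha> \<Phi> m B x w i"

end

theory Submission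
  imports Defs
begin

text \<open>
  Write \<open>q = (1 - \<alpha>) powr (1 / p)\<close> and let \<open>G j\<close> be the distribution function of the first \<open>j\<close> limiting
  suprema. Given the learning sample, the replicates are exchangeable, so the variance of their joint
  empirical distribution function at a fixed point is determined by the law of a pair of replicates;
  asymptotic independence of such a pair makes it vanish, whence pointwise convergence to \<open>G j\<close> in
  probability.

  As \<open>G j\<close> may have flat parts, the thresholds need not converge. Instead, by induction on \<open>j\<close>, there
  are deterministic \<open>l\<close> and \<open>u\<close> with \<open>G j l \<le> q ^ j \<le> G j u\<close> and \<open>G j u - G j l\<close> arbitrarily small such that
  the first \<open>j\<close> thresholds lie between \<open>l\<close> and \<open>u\<close> with probability tending to one. The weak
  convergence of the detector then squeezes the probability of no exceedance in the first \<open>j\<close>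
  sub-intervals to \<open>q ^ j\<close>. The law of a pair of replicates depends on the learning sample only, so
  that the upper bounds \<open>u\<close> also hold under the alternative, where the detector exceeds any constant.
\<close>

section \<open>Quantiles and thresholds\<close>

text \<open>The obstacle is that \<open>cond_edf\<close> conditions on thresholds computed from the
  same replicates, so its value at a point is not an average to which a law of large numbers
  applies. Numerator and denominator are therefore bounded separately by \<open>joint_edf\<close> at
  deterministic points. Each induction step involves four such points, so pointwise convergence is
  enough and no uniformity in the argument has to be established. The bracket for coordinate
  \<open>Suc j\<close> comes from solving for the levels at which even the worst combination of
  numerator and denominator stays on the right side of \<open>q\<close>. Continuity of the limit law
  makes these levels attainable and the boundaries of the boxes null. No conditional law given the
  learning sample is ever formed: a second moment about the limiting value involves only the
  probabilities of an event for one replicate and for two, and it yields the joint limit in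
  \<open>m\<close> and \<open>B\<close>.\<close>

lemma quantile_le: "y \<le> H u \<Longrightarrow> quantile H y \<le> ereal u"
  unfolding quantile_def by (intro Inf_lower) auto

lemma le_quantile:
  assumes "mono H" "H l < y"
  shows "ereal l \<le> quantile H y"
  unfolding quantile_def
proof (intro Inf_greatest, safe)
  fix x assume "y \<le> H x"
  then have "l \<le> x"
    using assms monoD[OF assms(1), of x l] by linarith
  then show "ereal l \<le> ereal x"
    by simp
qed

text \<open>A countable infimum, for the measurability of thresholds. Since \<open>H\<close> is
  monotone, every rational just above a point of the level set lies in the level set too, so each of
  its points is approached by rationals from above.\<close>

lemma quantile_eq_INF_Rats:
  assumes "mono H"
  shows "quantile H y = (INF r\<in>\<rat>. if y \<le> H r then ereal r else \<infinity>)"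
proof (rule antisym)
  show "quantile H y \<le> (INF r\<in>\<rat>. if y \<le> H r then ereal r else \<infinity>)"
    by (intro INF_greatest) (auto intro: quantile_le)
  show "(INF r\<in>\<rat>. if y \<le> H r then ereal r else \<infinity>) \<le> quantile H y"
    unfolding quantile_def
  proof (intro Inf_greatest, safe)
    fix x assume x: "y \<le> H x"
    show "(INF r\<in>\<rat>. if y \<le> H r then ereal r else \<infinity>) \<le> ereal x"
    proof (rule ereal_le_epsilon2)
      fix e :: real assume "0 < e"
      obtain r where r: "r \<in> \<rat>" "x < r" "r < x + e"
        using Rats_dense_in_real[of x "x + e"] \<open>0 < e\<close> by auto
      have "y \<le> H r"
        using x monoD[OF assms, of x r] r by simp
      then have "(INF r\<in>\<rat>. if y \<le> H r then ereal r else \<infinity>) \<le> ereal r"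
        using r by (intro INF_lower2[of r]) auto
      also have "\<dots> \<le> ereal x + ereal e"
        using r by simp
      finally show "(INF r\<in>\<rat>. if y \<le> H r then ereal r else \<infinity>) \<le> ereal x + ereal e" .
    qed
  qed
qed

text \<open>Only the numerator depends on the argument. If no replicate survives the conditioning,
  division by zero makes the function constantly 0, which is still monotone.\<close>

lemma mono_cond_edf: "mono (cond_edf s B g j)"
  unfolding cond_edf_def
  by (intro monoI divide_right_mono sum_mono sum_nonneg) (auto simp: of_bool_def)

text \<open>Strong induction: the counts in \<open>cond_edf\<close> compare measurable suprema with
  earlier thresholds, measurable by hypothesis, and the quantile is a countable infimum over values
  of \<open>cond_edf\<close> at rationals.\<close>

lemma threshold_seq_measurable:
  assumes s: "\<And>b i. b \<in> {1..B} \<Longrightarrow> i \<in> {1..p} \<Longrightarrow> (\<lambda>\<omega>. s \<omega> b i) \<in> borel_measurable M"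
  shows "j \<in> {1..p} \<Longrightarrow> (\<lambda>\<omega>. threshold_seq (s \<omega>) B y j) \<in> borel_measurable M"
proof (induction j rule: less_induct)
  case (less j)
  have g: "(\<lambda>\<omega>. threshold_seq (s \<omega>) B y i) \<in> borel_measurable M" if "i \<in> {1..<j}" for i
    using that less by auto
  have s': "(\<lambda>\<omega>. s \<omega> b i) \<in> borel_measurable M" if "b \<in> {1..B}" "i \<in> {1..<j}" for b i
    using that less.prems by (intro s) auto
  have sj: "(\<lambda>\<omega>. s \<omega> b j) \<in> borel_measurable M" if "b \<in> {1..B}" for b
    using that less.prems by (intro s) auto
  have pred: "{\<omega> \<in> space M. \<forall>i\<in>{1..<j}. ereal (s \<omega> b i) \<le> threshold_seq (s \<omega>) B y i} \<in> sets M"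
    if "b \<in> {1..B}" for b
    using s'[OF that] g by measurable
  have pred': "{\<omega> \<in> space M. s \<omega> b j \<le> x \<and>
      (\<forall>i\<in>{1..<j}. ereal (s \<omega> b i) \<le> threshold_seq (s \<omega>) B y i)} \<in> sets M"
    if "b \<in> {1..B}" for b x
    using pred[OF that] sj[OF that] by measurable
  have F [measurable]: "(\<lambda>\<omega>. cond_edf (s \<omega>) B (threshold_seq (s \<omega>) B y) j x) \<in> borel_measurable M" for x
    unfolding cond_edf_def of_bool_def
    by (intro borel_measurable_divide borel_measurable_sum measurable_If measurable_const pred pred') simp_all
  have "threshold_seq (s \<omega>) B y j =
      (INF r\<in>\<rat>. if y \<le> cond_edf (s \<omega>) B (threshold_seq (s \<omega>) B y) j r then ereal r else \<infinity>)" for \<omega>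
    by (subst threshold_seq.simps) (rule quantile_eq_INF_Rats[OF mono_cond_edf])
  moreover have "(\<lambda>\<omega>. INF r\<in>\<rat>. if y \<le> cond_edf (s \<omega>) B (threshold_seq (s \<omega>) B y) j r then ereal r else \<infinity>)
      \<in> borel_measurable M"
    by (intro borel_measurable_INF countable_rat) measurable
  ultimately show ?case
    by presburger
qed

text \<open>The empirical counterpart of \<open>G j\<close>. The bounds \<open>x\<close> are meant
  to be deterministic, in contrast to the random ones in \<open>cond_edf\<close>.\<close>

definition joint_edf :: "(nat \<Rightarrow> nat \<Rightarrow> real) \<Rightarrow> nat \<Rightarrow> nat \<Rightarrow> (nat \<Rightarrow> real) \<Rightarrow> real" where
  "joint_edf s B j x = (\<Sum>b=1..B. of_bool (\<forall>i\<in>{1..j}. s b i \<le> x i)) / real B"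

text \<open>The deterministic core of the induction. With the first \<open>j\<close> thresholds
  between \<open>l\<close> and \<open>u\<close>, the counts in \<open>cond_edf\<close> lie between
  those with \<open>l\<close> and those with \<open>u\<close> as conditioning bounds. Hypothesis
  \<open>up\<close> sets the smallest possible numerator at \<open>u'\<close> against the largest
  possible denominator, so that the ratio at \<open>u'\<close> is at least \<open>q\<close>;
  \<open>lo\<close> takes the opposite extremes at \<open>l'\<close>.\<close>

lemma threshold_seq_between:
  assumes g: "\<And>i. i \<in> {1..j} \<Longrightarrow>
      ereal (l i) \<le> threshold_seq s B q i \<and> threshold_seq s B q i \<le> ereal (u i)"
    and "0 < q"
    and up: "q * joint_edf s B j u < joint_edf s B (Suc j) (l(Suc j := u'))"
    and lo: "joint_edf s B (Suc j) (u(Suc j := l')) < q * joint_edf s B j l"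
  shows "ereal l' \<le> threshold_seq s B q (Suc j)" "threshold_seq s B q (Suc j) \<le> ereal u'"
proof -
  define K where "K j x = (\<Sum>b=1..B. of_bool (\<forall>i\<in>{1..j}. s b i \<le> x i) :: real)" for j x
  define num where
    "num x = (\<Sum>b=1..B. of_bool (s b (Suc j) \<le> x \<and> (\<forall>i\<in>{1..<Suc j}. ereal (s b i) \<le> threshold_seq s B q i)) :: real)" for x
  define den where
    "den = (\<Sum>b=1..B. of_bool (\<forall>i\<in>{1..<Suc j}. ereal (s b i) \<le> threshold_seq s B q i) :: real)"
  have F: "cond_edf s B (threshold_seq s B q) (Suc j) x = num x / den" for x
    by (simp only: cond_edf_def num_def den_def)
  \<comment> \<open>For \<open>B = 0\<close> both sides of \<open>lo\<close> are 0, against its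
    strictness.\<close>
  have "0 < B"
    using lo by (cases B) (auto simp: joint_edf_def)
  have below: "ereal (s b i) \<le> threshold_seq s B q i" if "s b i \<le> l i" "i \<in> {1..j}" for b i
    using g[OF that(2)] that(1) by (metis ereal_less_eq(3) order_trans)
  have above: "s b i \<le> u i" if "ereal (s b i) \<le> threshold_seq s B q i" "i \<in> {1..j}" for b i
    using g[OF that(2)] that(1) by (metis ereal_less_eq(3) order_trans)
  have Suc_int: "{1..<Suc j} = {1..j}" "{1..Suc j} = insert (Suc j) {1..j}"
    by auto
  have mono: "(\<Sum>b=1..B. of_bool (P b) :: real) \<le> (\<Sum>b=1..B. of_bool (Q b))"
    if "\<And>b. P b \<Longrightarrow> Q b" for P Q
    using that by (intro sum_mono) auto
  have "K (Suc j) (l(Suc j := u')) \<le> num u'" "num l' \<le> K (Suc j) (u(Suc j := l'))"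
      "K j l \<le> den" "den \<le> K j u" "num u' \<le> den"
    unfolding K_def num_def den_def Suc_int
    by ((rule mono; (auto simp: below above)[1])+)
  moreover have "0 \<le> num l'" "0 \<le> K j u"
    unfolding K_def num_def by (auto intro: sum_nonneg)
  moreover have "q * K j u < K (Suc j) (l(Suc j := u'))" "K (Suc j) (u(Suc j := l')) < q * K j l"
    using up lo \<open>0 < B\<close> by (simp_all add: joint_edf_def K_def field_simps)
  moreover have "q * K j l \<le> q * den" "q * den \<le> q * K j u" "0 \<le> q * K j u"
    using calculation \<open>0 < q\<close> by (auto intro: mult_left_mono)
  ultimately have *: "num l' < q * den" "q * den \<le> num u'" "0 < q * den"
    by linarith+
  \<comment> \<open>Some replicate survives the conditioning, because \<open>lo\<close> puts a
    nonnegative count strictly below \<open>q * den\<close>. Only now is the quotient free of the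
    division by zero convention.\<close>
  then have "0 < den"
    using \<open>0 < q\<close> by (simp add: zero_less_mult_iff)
  with * have "num l' / den < q" "q \<le> num u' / den"
    by (auto simp: field_simps)
  then show "ereal l' \<le> threshold_seq s B q (Suc j)" "threshold_seq s B q (Suc j) \<le> ereal u'"
    by (subst threshold_seq.simps, intro le_quantile[OF mono_cond_edf] quantile_le, simp only: F)+
qed

section \<open>Events of probability tending to one\<close>

text \<open>
  With high probability. The event need not be measurable, it only has to contain a measurable event
  of large probability.
\<close>

definition whp :: "(nat \<Rightarrow> 'a measure) \<Rightarrow> (nat \<Rightarrow> nat \<Rightarrow> 'a \<Rightarrow> bool) \<Rightarrow> bool" where
  "whp M Q \<longleftrightarrow> (\<forall>e>0. \<forall>\<^sub>F (m, B) in sequentially \<times>\<^sub>F sequentially.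
     \<exists>A\<in>sets (M m). 1 - e \<le> measure (M m) A \<and> (\<forall>\<omega>\<in>A. Q m B \<omega>))"

lemma eventually_prod_sequentially:
  "(\<And>m B. k \<le> m \<Longrightarrow> l \<le> B \<Longrightarrow> P (m, B)) \<Longrightarrow> eventually P (sequentially \<times>\<^sub>F sequentially)"
  unfolding eventually_prod_filter
  by (rule exI[of _ "\<lambda>m. k \<le> m"], rule exI[of _ "\<lambda>B. l \<le> B"]) (simp add: eventually_ge_at_top)

lemma whp_mono:
  assumes "whp M Q" "\<And>m B \<omega>. 1 \<le> m \<Longrightarrow> \<omega> \<in> space (M m) \<Longrightarrow> Q m B \<omega> \<Longrightarrow> Q' m B \<omega>"
  shows "whp M Q'"
  unfolding whp_def
proof (intro allI impI)
  fix e :: real assume "0 < e"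
  then have "\<forall>\<^sub>F (m, B) in sequentially \<times>\<^sub>F sequentially.
      \<exists>A\<in>sets (M m). 1 - e \<le> measure (M m) A \<and> (\<forall>\<omega>\<in>A. Q m B \<omega>)"
    using assms(1) by (simp add: whp_def)
  moreover have "\<forall>\<^sub>F (m, B) in sequentially \<times>\<^sub>F sequentially. (1::nat) \<le> m"
    by (rule eventually_prod_sequentially[of 1 0]) auto
  ultimately show "\<forall>\<^sub>F (m, B) in sequentially \<times>\<^sub>F sequentially.
      \<exists>A\<in>sets (M m). 1 - e \<le> measure (M m) A \<and> (\<forall>\<omega>\<in>A. Q' m B \<omega>)"
  proof eventually_elim
    case (elim x)
    obtain m B where x: "x = (m, B)"
      by (cases x)
    with elim obtain A where "A \<in> sets (M m)" "1 - e \<le> measure (M m) A" "\<forall>\<omega>\<in>A. Q m B \<omega>" "1 \<le> m"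
      by auto
    then show ?case
      unfolding x using assms(2) sets.sets_into_space by blast
  qed
qed

lemma whp_True:
  assumes "\<And>m. 1 \<le> m \<Longrightarrow> prob_space (M m)"
  shows "whp M (\<lambda>_ _ _. True)"
  unfolding whp_def
proof (intro allI impI eventually_prod_sequentially[of 1 0])
  fix e :: real and m B :: nat assume "0 < e" "1 \<le> m"
  then show "case (m, B) of (m, B) \<Rightarrow> \<exists>A\<in>sets (M m). 1 - e \<le> measure (M m) A \<and> (\<forall>\<omega>\<in>A. True)"
    using prob_space.prob_space[OF assms] by (auto intro!: bexI[of _ "space (M m)"])
qed

lemma whp_conj:
  assumes "\<And>m. 1 \<le> m \<Longrightarrow> prob_space (M m)" "whp M Q" "whp M Q'"
  shows "whp M (\<lambda>m B \<omega>. Q m B \<omega> \<and> Q' m B \<omega>)"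
  unfolding whp_def
proof (intro allI impI)
  fix e :: real assume "0 < e"
  have "\<forall>\<^sub>F (m, B) in sequentially \<times>\<^sub>F sequentially.
      \<exists>A\<in>sets (M m). 1 - e / 2 \<le> measure (M m) A \<and> (\<forall>\<omega>\<in>A. Q m B \<omega>)"
    "\<forall>\<^sub>F (m, B) in sequentially \<times>\<^sub>F sequentially.
      \<exists>A\<in>sets (M m). 1 - e / 2 \<le> measure (M m) A \<and> (\<forall>\<omega>\<in>A. Q' m B \<omega>)"
    using assms(2,3) \<open>0 < e\<close> by (simp_all add: whp_def)
  moreover have "\<forall>\<^sub>F (m, B) in sequentially \<times>\<^sub>F sequentially. (1::nat) \<le> m"
    by (rule eventually_prod_sequentially[of 1 0]) auto
  ultimately show "\<forall>\<^sub>F (m, B) in sequentially \<times>\<^sub>F sequentially.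
      \<exists>A\<in>sets (M m). 1 - e \<le> measure (M m) A \<and> (\<forall>\<omega>\<in>A. Q m B \<omega> \<and> Q' m B \<omega>)"
  proof eventually_elim
    case (elim x)
    obtain m B where x: "x = (m, B)"
      by (cases x)
    with elim obtain A A' where A: "A \<in> sets (M m)" "1 - e / 2 \<le> measure (M m) A" "\<forall>\<omega>\<in>A. Q m B \<omega>"
      "A' \<in> sets (M m)" "1 - e / 2 \<le> measure (M m) A'" "\<forall>\<omega>\<in>A'. Q' m B \<omega>" and "1 \<le> m"
      by auto
    interpret prob_space "M m"
      by (rule assms(1)) fact
    have "prob (A \<union> A') = prob A + prob A' - prob (A \<inter> A')"
      using A finite_measure_Union'[of A A'] finite_measure_Diff'[of A' A] by (simp add: Int_commute)
    then have "1 - e \<le> prob (A \<inter> A')"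
      using prob_le_1[of "A \<union> A'"] A by simp
    then show ?case
      unfolding x using A by (auto intro!: bexI[of _ "A \<inter> A'"])
  qed
qed

lemma whp_of_tendsto:
  assumes "((\<lambda>(m, B). \<P>(\<omega> in M m. Q m B \<omega>)) \<longlongrightarrow> 1) (sequentially \<times>\<^sub>F sequentially)"
  shows "whp M Q"
  unfolding whp_def
proof (intro allI impI)
  fix e :: real assume "0 < e"
  \<comment> \<open>The maximum with 0 makes the probability positive, which forces the event to be
    measurable, as \<open>measure\<close> is 0 outside the sigma-algebra.\<close>
  have "\<forall>\<^sub>F x in sequentially \<times>\<^sub>F sequentially.
      max 0 (1 - e) < (case x of (m, B) \<Rightarrow> \<P>(\<omega> in M m. Q m B \<omega>))"
    by (rule order_tendstoD(1)[OF assms]) (use \<open>0 < e\<close> in auto)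
  then show "\<forall>\<^sub>F (m, B) in sequentially \<times>\<^sub>F sequentially.
      \<exists>A\<in>sets (M m). 1 - e \<le> measure (M m) A \<and> (\<forall>\<omega>\<in>A. Q m B \<omega>)"
  proof eventually_elim
    case (elim x)
    obtain m B where x: "x = (m, B)"
      by (cases x)
    with elim have "max 0 (1 - e) < \<P>(\<omega> in M m. Q m B \<omega>)"
      by simp
    moreover from this have "{\<omega> \<in> space (M m). Q m B \<omega>} \<in> sets (M m)"
      using measure_notin_sets by fastforce
    ultimately show ?case
      unfolding x by (auto intro!: bexI[of _ "{\<omega> \<in> space (M m). Q m B \<omega>}"])
  qed
qed

text \<open>\<open>Lo\<close> and \<open>Up\<close> are meant to have deterministic bounds in place
  of thresholds. They do not depend on \<open>B\<close>, so weak convergence in \<open>m\<close>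
  alone gives their limits. The bracket may change with \<open>e\<close>, as it must when the
  thresholds themselves do not converge.\<close>

lemma tendsto_sandwich_whp:
  assumes M: "\<And>m. 1 \<le> m \<Longrightarrow> prob_space (M m)"
    and E: "\<And>m B. 1 \<le> m \<Longrightarrow> {\<omega> \<in> space (M m). E m B \<omega>} \<in> sets (M m)"
    and approx: "\<And>e. 0 < e \<Longrightarrow> \<exists>Lo Up a b.
      (\<forall>m\<ge>1. {\<omega> \<in> space (M m). Lo m \<omega>} \<in> sets (M m) \<and> {\<omega> \<in> space (M m). Up m \<omega>} \<in> sets (M m)) \<and>
      whp M (\<lambda>m B \<omega>. (Lo m \<omega> \<longrightarrow> E m B \<omega>) \<and> (E m B \<omega> \<longrightarrow> Up m \<omega>)) \<and>
      (\<lambda>m. \<P>(\<omega> in M m. Lo m \<omega>)) \<longlonglongrightarrow> a \<and> (\<lambda>m. \<P>(\<omega> in M m. Up m \<omega>)) \<longlonglongrightarrow> b \<and>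
      c - e < a \<and> b < c + e"
  shows "((\<lambda>(m, B). \<P>(\<omega> in M m. E m B \<omega>)) \<longlongrightarrow> c) (sequentially \<times>\<^sub>F sequentially)"
proof (rule tendstoI)
  fix e :: real assume "0 < e"
  then have "0 < e / 2"
    by simp
  from approx[OF this] obtain Lo Up a b where
    *: "\<forall>m\<ge>1. {\<omega> \<in> space (M m). Lo m \<omega>} \<in> sets (M m) \<and> {\<omega> \<in> space (M m). Up m \<omega>} \<in> sets (M m)" and
    whp: "whp M (\<lambda>m B \<omega>. (Lo m \<omega> \<longrightarrow> E m B \<omega>) \<and> (E m B \<omega> \<longrightarrow> Up m \<omega>))" and
    lim: "(\<lambda>m. \<P>(\<omega> in M m. Lo m \<omega>)) \<longlonglongrightarrow> a" "(\<lambda>m. \<P>(\<omega> in M m. Up m \<omega>)) \<longlonglongrightarrow> b" and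
    ab: "c - e / 2 < a" "b < c + e / 2"
    by (elim exE conjE) (rule that)
  have sets: "{\<omega> \<in> space (M m). Lo m \<omega>} \<in> sets (M m)" "{\<omega> \<in> space (M m). Up m \<omega>} \<in> sets (M m)"
    if "1 \<le> m" for m
    using * that by blast+
  have "\<forall>\<^sub>F m in sequentially. c - e / 2 < \<P>(\<omega> in M m. Lo m \<omega>) \<and> \<P>(\<omega> in M m. Up m \<omega>) < c + e / 2"
    using order_tendstoD(1)[OF lim(1) ab(1)] order_tendstoD(2)[OF lim(2) ab(2)]
    by (rule eventually_conj)
  then have "\<forall>\<^sub>F (m, B) in sequentially \<times>\<^sub>F sequentially.
      c - e / 2 < \<P>(\<omega> in M m. Lo m \<omega>) \<and> \<P>(\<omega> in M m. Up m \<omega>) < c + e / 2"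
    unfolding eventually_prod_filter case_prod_conv
    by (blast intro: always_eventually)
  moreover have "\<forall>\<^sub>F (m, B) in sequentially \<times>\<^sub>F sequentially. \<exists>A\<in>sets (M m).
      1 - e / 2 \<le> measure (M m) A \<and> (\<forall>\<omega>\<in>A. (Lo m \<omega> \<longrightarrow> E m B \<omega>) \<and> (E m B \<omega> \<longrightarrow> Up m \<omega>))"
    using whp \<open>0 < e\<close> by (simp add: whp_def)
  moreover have "\<forall>\<^sub>F (m, B) in sequentially \<times>\<^sub>F sequentially. (1::nat) \<le> m"
    by (rule eventually_prod_sequentially[of 1 0]) auto
  ultimately show "\<forall>\<^sub>F x in sequentially \<times>\<^sub>F sequentially.
      dist (case x of (m, B) \<Rightarrow> \<P>(\<omega> in M m. E m B \<omega>)) c < e"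
  proof eventually_elim
    case (elim x)
    obtain m B where x: "x = (m, B)"
      by (cases x)
    with elim obtain A where A: "A \<in> sets (M m)" "1 - e / 2 \<le> measure (M m) A"
        "\<And>\<omega>. \<omega> \<in> A \<Longrightarrow> Lo m \<omega> \<Longrightarrow> E m B \<omega>" "\<And>\<omega>. \<omega> \<in> A \<Longrightarrow> E m B \<omega> \<Longrightarrow> Up m \<omega>"
      and "1 \<le> m"
      and lim: "c - e / 2 < \<P>(\<omega> in M m. Lo m \<omega>)" "\<P>(\<omega> in M m. Up m \<omega>) < c + e / 2"
      by auto
    interpret prob_space "M m"
      by (rule M) fact
    note [measurable] = sets[OF \<open>1 \<le> m\<close>] E[OF \<open>1 \<le> m\<close>, of B] A(1)
    have compl: "prob (space (M m) - A) \<le> e / 2"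
      using prob_compl[OF A(1)] A(2) by simp
    have "\<P>(\<omega> in M m. Lo m \<omega>) \<le> prob ({\<omega> \<in> space (M m). E m B \<omega>} \<union> (space (M m) - A))"
      using A(3) by (intro finite_measure_mono) auto
    also have "\<dots> \<le> \<P>(\<omega> in M m. E m B \<omega>) + e / 2"
      using compl by (intro order_trans[OF measure_Un_le]) auto
    finally have 1: "c - e < \<P>(\<omega> in M m. E m B \<omega>)"
      using lim by simp
    have "\<P>(\<omega> in M m. E m B \<omega>) \<le> prob ({\<omega> \<in> space (M m). Up m \<omega>} \<union> (space (M m) - A))"
      using A(4) by (intro finite_measure_mono) auto
    also have "\<dots> \<le> \<P>(\<omega> in M m. Up m \<omega>) + e / 2"
      using compl by (intro order_trans[OF measure_Un_le]) auto
    finally show ?case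
      using 1 lim unfolding x by (simp add: dist_real_def)
  qed
qed

text \<open>The intermediate value theorem for the distribution function of \<open>U\<close> on
  \<open>A\<close>: absence of atoms makes it continuous, and it increases from 0 to
  \<open>prob A\<close>. This produces the new bounds in the induction on sub-intervals.\<close>

lemma (in prob_space) exists_level:
  fixes U :: "'a \<Rightarrow> real"
  assumes [measurable]: "A \<in> events" "U \<in> borel_measurable M"
    and atomless: "\<And>c. prob {\<omega> \<in> space M. U \<omega> = c} = 0"
    and y: "0 < y" "y < prob A"
  shows "\<exists>x. prob {\<omega> \<in> A. U \<omega> \<le> x} = y"
proof -
  have A: "A \<subseteq> space M"
    by (rule sets.sets_into_space) fact
  define \<nu> where "\<nu> = distr (restrict_space M A) borel U"
  have U: "U \<in> borel_measurable (restrict_space M A)"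
    by (rule measurable_restrict_space1) fact
  have \<nu>: "measure \<nu> C = prob {\<omega> \<in> A. U \<omega> \<in> C}" if "C \<in> sets borel" for C
    using that A U unfolding \<nu>_def
    by (subst measure_distr) (auto simp: space_restrict_space measure_restrict_space Int_absorb2
        intro!: arg_cong[of _ _ prob])
  have "finite_measure (restrict_space M A)"
    by (rule finite_measure_restrict_space) auto
  then have "finite_measure \<nu>"
    unfolding \<nu>_def using U by (rule finite_measure.finite_measure_distr)
  then interpret \<nu>: finite_borel_measure \<nu>
    by (simp add: finite_borel_measure_def finite_borel_measure_axioms_def \<nu>_def)
  have cdf: "cdf \<nu> x = prob {\<omega> \<in> A. U \<omega> \<le> x}" for x
    by (simp add: cdf_def \<nu>)
  have "prob {\<omega> \<in> A. U \<omega> = c} = 0" for c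
    using finite_measure_mono[of "{\<omega> \<in> A. U \<omega> = c}" "{\<omega> \<in> space M. U \<omega> = c}"] atomless[of c] A
    by (auto simp: measure_le_0_iff subset_eq)
  then have cont: "isCont (cdf \<nu>) x" for x
    by (simp add: \<nu>.isCont_cdf \<nu>)
  have "\<forall>\<^sub>F x in at_bot. cdf \<nu> x < y" "\<forall>\<^sub>F x in at_top. y < cdf \<nu> x"
    using order_tendstoD(2)[OF \<nu>.cdf_lim_at_bot \<open>0 < y\<close>]
      order_tendstoD(1)[OF \<nu>.cdf_lim_at_top, of y] \<open>y < prob A\<close> \<nu>[of UNIV]
    by (simp_all add: \<nu>.borel_UNIV)
  then obtain l u where lu: "cdf \<nu> l < y" "y < cdf \<nu> u"
    by (meson eventually_happens trivial_limit_at_bot_linorder trivial_limit_at_top_linorder)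
  then have "l \<le> u"
    using \<nu>.cdf_nondecreasing[of u l] by linarith
  then show ?thesis
    using IVT[of "cdf \<nu>" l y u] lu cont cdf by auto
qed

lemma tendsto_fst_snd:
  assumes "(f \<longlongrightarrow> c) F" 
  shows "((\<lambda>(x, y). f x) \<longlongrightarrow> c) (F \<times>\<^sub>F G)" "((\<lambda>(y, x). f x) \<longlongrightarrow> c) (G \<times>\<^sub>F F)"
  using filterlim_compose[OF assms filterlim_fst[of F G]] filterlim_compose[OF assms filterlim_snd[of F G]]
  by (simp_all add: case_prod_unfold)

text \<open>Chebyshev's inequality with the second moment taken about the limit \<open>c\<close>
  instead of the mean. Of the \<open>B\<^sup>2\<close> pairs, \<open>B\<close> are diagonal and
  contribute \<open>p1 m\<close>, the others \<open>p2 m\<close>; this gives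
  \<open>v (m, B)\<close>, with limit \<open>c\<^sup>2 - 2 * c * c + c\<^sup>2 = 0\<close>. The
  condition on pairs is asymptotic because replicates share the learning sample and may be dependent
  for every fixed \<open>m\<close>.\<close>

lemma average_whp:
  fixes E :: "nat \<Rightarrow> nat \<Rightarrow> 'a \<Rightarrow> bool" and c :: real
  assumes M: "\<And>m. 1 \<le> m \<Longrightarrow> prob_space (M m)"
    and E: "\<And>m b. 1 \<le> m \<Longrightarrow> 1 \<le> b \<Longrightarrow> {\<omega> \<in> space (M m). E m b \<omega>} \<in> sets (M m)"
    and p1: "\<And>m b. 1 \<le> m \<Longrightarrow> 1 \<le> b \<Longrightarrow> \<P>(\<omega> in M m. E m b \<omega>) = p1 m"
    and p2: "\<And>m b b'. 1 \<le> m \<Longrightarrow> 1 \<le> b \<Longrightarrow> 1 \<le> b' \<Longrightarrow> b \<noteq> b' \<Longrightarrow>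
      \<P>(\<omega> in M m. E m b \<omega> \<and> E m b' \<omega>) = p2 m"
    and lim: "p1 \<longlonglongrightarrow> c" "p2 \<longlonglongrightarrow> c\<^sup>2" and "0 < \<eta>"
  shows "whp M (\<lambda>m B \<omega>. \<bar>(\<Sum>b=1..B. of_bool (E m b \<omega>)) / real B - c\<bar> < \<eta>)"
proof (rule whp_of_tendsto)
  define v where
    "v = (\<lambda>(m, B). p1 m * inverse (real B) + (1 - inverse (real B)) * p2 m - 2 * c * p1 m + c\<^sup>2)"
  have "(v \<longlongrightarrow> c * 0 + (1 - 0) * c\<^sup>2 - 2 * c * c + c\<^sup>2) (sequentially \<times>\<^sub>F sequentially)"
    unfolding v_def case_prod_unfold
    by (intro tendsto_intros tendsto_fst_snd[unfolded case_prod_unfold] lim LIMSEQ_inverse_real_of_nat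
        lim_inverse_n)
  then have "(v \<longlongrightarrow> 0) (sequentially \<times>\<^sub>F sequentially)"
    by (simp add: power2_eq_square)
  then have "((\<lambda>x. 1 - v x / \<eta>\<^sup>2) \<longlongrightarrow> 1 - 0 / \<eta>\<^sup>2) (sequentially \<times>\<^sub>F sequentially)"
    by (intro tendsto_intros) (use \<open>0 < \<eta>\<close> in auto)
  then have lower: "((\<lambda>x. 1 - v x / \<eta>\<^sup>2) \<longlongrightarrow> 1) (sequentially \<times>\<^sub>F sequentially)"
    by simp
  have bound: "1 - v (m, B) / \<eta>\<^sup>2 \<le>
      \<P>(\<omega> in M m. \<bar>(\<Sum>b=1..B. of_bool (E m b \<omega>)) / real B - c\<bar> < \<eta>) \<and>
      \<P>(\<omega> in M m. \<bar>(\<Sum>b=1..B. of_bool (E m b \<omega>)) / real B - c\<bar> < \<eta>) \<le> 1"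
    if "1 \<le> m" "1 \<le> B" for m B
  proof -
    interpret prob_space "M m"
      by (rule M) fact
    have [measurable]: "{\<omega> \<in> space (M m). E m b \<omega>} \<in> events" if "b \<in> {1..B}" for b
      using that E[OF \<open>1 \<le> m\<close>] by simp
    define f where "f b \<omega> = (of_bool (E m b \<omega>) :: real)" for b \<omega>
    have f [measurable]: "f b \<in> borel_measurable (M m)" if [measurable]: "b \<in> {1..B}" for b
      unfolding f_def of_bool_def by measurable
    have ff: "(\<lambda>\<omega>. f b \<omega> * f b' \<omega>) \<in> borel_measurable (M m)" if "b \<in> {1..B}" "b' \<in> {1..B}" for b b'
      using f[OF that(1)] f[OF that(2)] by measurable
    have int: "integrable (M m) (f b)" if "b \<in> {1..B}" for b
      using f[OF that] by (intro integrable_const_bound[of _ 1]) (auto simp: f_def)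
    have int2: "integrable (M m) (\<lambda>\<omega>. f b \<omega> * f b' \<omega>)" if "b \<in> {1..B}" "b' \<in> {1..B}" for b b'
      using ff[OF that] by (intro integrable_const_bound[of _ 1]) (auto simp: f_def)
    have E1: "expectation (f b) = p1 m" if "b \<in> {1..B}" for b
    proof -
      have "expectation (f b) = expectation (indicator {\<omega> \<in> space (M m). E m b \<omega>})"
        by (intro Bochner_Integration.integral_cong) (auto simp: f_def)
      then show ?thesis
        using that p1[OF \<open>1 \<le> m\<close>, of b] E[OF \<open>1 \<le> m\<close>, of b] by simp
    qed
    have E2: "expectation (\<lambda>\<omega>. f b \<omega> * f b' \<omega>) = (if b = b' then p1 m else p2 m)"
      if "b \<in> {1..B}" "b' \<in> {1..B}" for b b'
    proof (cases "b = b'")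
      case True
      then have "(\<lambda>\<omega>. f b \<omega> * f b' \<omega>) = f b"
        by (auto simp: f_def fun_eq_iff)
      then show ?thesis
        using E1 that True by simp
    next
      case False
      have "{\<omega> \<in> space (M m). E m b \<omega> \<and> E m b' \<omega>} \<in> events"
        using E[OF \<open>1 \<le> m\<close>, of b] E[OF \<open>1 \<le> m\<close>, of b'] that by (auto intro: sets.sets_Collect_conj)
      moreover have "expectation (\<lambda>\<omega>. f b \<omega> * f b' \<omega>) =
          expectation (indicator {\<omega> \<in> space (M m). E m b \<omega> \<and> E m b' \<omega>})"
        by (intro Bochner_Integration.integral_cong) (auto simp: f_def)
      ultimately show ?thesis
        using that p2[OF \<open>1 \<le> m\<close>, of b b'] False by simp
    qed
    define S1 S2 where "S1 \<omega> = (\<Sum>b=1..B. f b \<omega>)"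
      and "S2 \<omega> = (\<Sum>b=1..B. \<Sum>b'=1..B. f b \<omega> * f b' \<omega>)" for \<omega>
    define h where "h \<omega> = S1 \<omega> / real B - c" for \<omega>
    have [measurable]: "integrable (M m) S1" "integrable (M m) S2"
      unfolding S1_def S2_def using int int2 by (auto intro!: Bochner_Integration.integrable_sum)
    have ES: "expectation S1 = (\<Sum>b=1..B. p1 m)"
        "expectation S2 = (\<Sum>b=1..B. \<Sum>b'=1..B. if b = b' then p1 m else p2 m)"
      unfolding S1_def S2_def using int int2 E1 E2
      by (subst Bochner_Integration.integral_sum, auto intro!: sum.cong Bochner_Integration.integrable_sum)+
    have h: "h \<in> borel_measurable (M m)"
      unfolding h_def using \<open>integrable (M m) S1\<close> by measurable
    have h2: "(h \<omega>)\<^sup>2 = S2 \<omega> / (real B)\<^sup>2 - 2 * c / real B * S1 \<omega> + c\<^sup>2" for \<omega>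
      unfolding h_def S1_def S2_def sum_product[symmetric] power2_diff by (simp add: power2_eq_square)
    have int_h2: "integrable (M m) (\<lambda>\<omega>. (h \<omega>)\<^sup>2)"
      unfolding h2 using \<open>integrable (M m) S1\<close> \<open>integrable (M m) S2\<close> by simp
    have "expectation (\<lambda>\<omega>. (h \<omega>)\<^sup>2) =
        (\<Sum>b=1..B. \<Sum>b'=1..B. if b = b' then p1 m else p2 m) / (real B)\<^sup>2
        - 2 * c / real B * (\<Sum>b=1..B. p1 m) + c\<^sup>2"
      unfolding h2 ES[symmetric] using \<open>integrable (M m) S1\<close> \<open>integrable (M m) S2\<close>
      by (simp add: prob_space)
    also have "(\<Sum>b=1..B. \<Sum>b'=1..B. if b = b' then p1 m else p2 m) =
        (\<Sum>b=1..B. p1 m + (real B - 1) * p2 m)"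
    proof (rule sum.cong)
      fix b assume b: "b \<in> {1..B}"
      have "(\<Sum>b'=1..B. if b = b' then p1 m else p2 m) = p1 m + (\<Sum>b'\<in>{1..B} - {b}. p2 m)"
        using b by (subst sum.remove[of _ b]) (auto intro: sum.cong)
      then show "(\<Sum>b'=1..B. if b = b' then p1 m else p2 m) = p1 m + (real B - 1) * p2 m"
        using b by (simp add: of_nat_diff)
    qed simp
    finally have v: "expectation (\<lambda>\<omega>. (h \<omega>)\<^sup>2) = v (m, B)"
      using \<open>1 \<le> B\<close> by (simp add: v_def power2_eq_square field_simps)
    have "prob {\<omega> \<in> space (M m). \<eta> \<le> \<bar>h \<omega>\<bar>} \<le> v (m, B) / \<eta>\<^sup>2"
      using second_moment_method[OF h int_h2 \<open>0 < \<eta>\<close>] v by simp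
    moreover have "prob {\<omega> \<in> space (M m). \<eta> \<le> \<bar>h \<omega>\<bar>} = 1 - prob {\<omega> \<in> space (M m). \<bar>h \<omega>\<bar> < \<eta>}"
      using h by (subst prob_neg[symmetric]) (auto simp: not_less)
    ultimately show ?thesis
      by (auto simp: h_def S1_def f_def)
  qed
  have ev: "\<forall>\<^sub>F x in sequentially \<times>\<^sub>F sequentially. 1 - v x / \<eta>\<^sup>2 \<le>
      (case x of (m, B) \<Rightarrow> \<P>(\<omega> in M m. \<bar>(\<Sum>b=1..B. of_bool (E m b \<omega>)) / real B - c\<bar> < \<eta>))"
    "\<forall>\<^sub>F x in sequentially \<times>\<^sub>F sequentially.
      (case x of (m, B) \<Rightarrow> \<P>(\<omega> in M m. \<bar>(\<Sum>b=1..B. of_bool (E m b \<omega>)) / real B - c\<bar> < \<eta>)) \<le> 1"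
    using bound by (auto intro!: eventually_prod_sequentially[of 1 1])
  show "((\<lambda>(m, B). \<P>(\<omega> in M m. \<bar>(\<Sum>b=1..B. of_bool (E m b \<omega>)) / real B - c\<bar> < \<eta>))
      \<longlongrightarrow> 1) (sequentially \<times>\<^sub>F sequentially)"
    by (rule tendsto_sandwich[OF ev lower tendsto_const])
qed

text \<open>The width \<open>e\<close> is generalised in the induction because the bracket for
  \<open>j\<close> has to be taken much narrower than the one wanted for \<open>Suc j\<close>.
  Earlier bounds are kept and only one coordinate is added.\<close>

lemma (in prob_space) thresholds_whp:
  fixes U :: "nat \<Rightarrow> 'a \<Rightarrow> real" and s :: "nat \<Rightarrow> 'b \<Rightarrow> nat \<Rightarrow> nat \<Rightarrow> real"
  defines "G \<equiv> \<lambda>j x. prob {\<omega> \<in> space M. \<forall>i\<in>{1..j}. U i \<omega> \<le> x i}"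
  assumes U: "\<And>i. i \<in> {1..p} \<Longrightarrow> U i \<in> borel_measurable M"
    and atomless: "\<And>i c. i \<in> {1..p} \<Longrightarrow> prob {\<omega> \<in> space M. U i \<omega> = c} = 0"
    and N: "\<And>m. 1 \<le> m \<Longrightarrow> prob_space (N m)"
    and edf: "\<And>j x \<eta>. j \<le> p \<Longrightarrow> 0 < \<eta> \<Longrightarrow> whp N (\<lambda>m B \<omega>. \<bar>joint_edf (s m \<omega>) B j x - G j x\<bar> < \<eta>)"
    and q: "0 < q" "q < 1"
  shows "j \<le> p \<Longrightarrow> 0 < e \<Longrightarrow> \<exists>l u. (\<forall>i. l i \<le> u i) \<and> G j u - G j l < e \<and> G j l \<le> q ^ j \<and> q ^ j \<le> G j u \<and>
    whp N (\<lambda>m B \<omega>. \<forall>i\<in>{1..j}.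
      ereal (l i) \<le> threshold_seq (s m \<omega>) B q i \<and> threshold_seq (s m \<omega>) B q i \<le> ereal (u i))"
proof (induction j arbitrary: e)
  case 0
  \<comment> \<open>With no constraint, \<open>G 0\<close> is constantly 1, which is
    \<open>q ^ 0\<close>, so any bounds do.\<close>
  have "whp N (\<lambda>_ _ _. True)"
    by (rule whp_True) (rule N)
  then show ?case
    using \<open>0 < e\<close> by (auto simp: G_def prob_space)
next
  case (Suc j)
  have events: "{\<omega> \<in> space M. \<forall>i\<in>{1..k}. U i \<omega> \<le> x i} \<in> events" if "k \<le> p" for k x
    using U that by (intro sets.sets_Collect_finite_All borel_measurable_le) auto
  have G_mono: "G k x \<le> G k y" if "k \<le> p" "\<And>i. i \<in> {1..k} \<Longrightarrow> x i \<le> y i" for k x y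
    unfolding G_def using that by (intro finite_measure_mono events) (auto intro: order_trans)
  have G_Suc: "G (Suc j) (x(Suc j := t)) = prob {\<omega> \<in> {\<omega> \<in> space M. \<forall>i\<in>{1..j}. U i \<omega> \<le> x i}. U (Suc j) \<omega> \<le> t}" for x t
  proof -
    have "{1..Suc j} = insert (Suc j) {1..j}"
      by auto
    then show ?thesis
      unfolding G_def by (auto intro!: arg_cong[of _ _ prob])
  qed
  \<comment> \<open>\<open>l'\<close> and \<open>u'\<close> below put a margin \<open>d\<close> between the conditional distribution function and \<open>q\<close>, which
    absorbs the sampling error.\<close>
  define d where "d = min (e / 6) (min ((1 - q) * q ^ j / 2) (q * q ^ j / 2))"
  have d: "0 < d" "6 * d \<le> e" "2 * d \<le> (1 - q) * q ^ j" "2 * d \<le> q * q ^ j"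
    using q \<open>0 < e\<close> by (auto simp: d_def)
  obtain l u where lu: "\<And>i. l i \<le> u i" and diff: "G j u - G j l < d" and lq: "G j l \<le> q ^ j" and qu: "q ^ j \<le> G j u"
    and whp: "whp N (\<lambda>m B \<omega>. \<forall>i\<in>{1..j}.
      ereal (l i) \<le> threshold_seq (s m \<omega>) B q i \<and> threshold_seq (s m \<omega>) B q i \<le> ereal (u i))"
    using Suc.IH[OF _ \<open>0 < d\<close>] Suc.prems(1) by auto
  \<comment> \<open>Room for the level of \<open>u'\<close> inside the box at \<open>l\<close>: the
    bound \<open>2 * d \<le> (1 - q) * q ^ j\<close> gives
    \<open>q * G j u + 2 * d \<le> G j u\<close>, and \<open>G j l\<close> falls short of
    \<open>G j u\<close> by less than \<open>d\<close>.\<close>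
  have "q * G j u + d < G j l"
  proof -
    have "(1 - q) * q ^ j \<le> (1 - q) * G j u"
      using qu q by (intro mult_left_mono) auto
    then show ?thesis
      using d diff by (simp add: algebra_simps)
  qed
  moreover have "0 \<le> q * G j u"
    using q by (simp add: G_def)
  \<comment> \<open>\<open>u'\<close> is solved for in the smaller box at \<open>l\<close>, but
    against the larger mass \<open>G j u\<close>: the worst case in hypothesis \<open>up\<close> of
    \<open>threshold_seq_between\<close>, with margin \<open>d\<close>. The choice of
    \<open>l'\<close> below exchanges the roles of \<open>l\<close> and \<open>u\<close>.\<close>
  ultimately obtain u' where u': "G (Suc j) (l(Suc j := u')) = q * G j u + d"
    using exists_level[of "{\<omega> \<in> space M. \<forall>i\<in>{1..j}. U i \<omega> \<le> l i}" "U (Suc j)" "q * G j u + d"]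
      events[of j l] U[of "Suc j"] atomless[of "Suc j"] Suc.prems(1) \<open>0 < d\<close>
    by (auto simp: G_Suc) (auto simp: G_def)
  \<comment> \<open>Here the cap \<open>2 * d \<le> q * q ^ j\<close> is used: the level of
    \<open>l'\<close> has to be positive to be attained at a finite point.\<close>
  have "0 < q * G j l - d"
  proof -
    have "q * q ^ j - q * d < q * G j l"
      using diff qu q mult_strict_left_mono[of "q ^ j - d" "G j l" q] by (simp add: right_diff_distrib)
    moreover have "q * d \<le> 1 * d"
      using q \<open>0 < d\<close> by (intro mult_right_mono) auto
    ultimately show ?thesis
      using d by linarith
  qed
  moreover have "q * G j l - d < G j u"
  proof -
    have "q * G j l \<le> G j l"
      using q by (simp add: G_def mult_left_le_one_le)
    then show ?thesis
      using G_mono[of j l u] lu Suc.prems(1) \<open>0 < d\<close> by simp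
  qed
  ultimately obtain l' where l': "G (Suc j) (u(Suc j := l')) = q * G j l - d"
    using exists_level[of "{\<omega> \<in> space M. \<forall>i\<in>{1..j}. U i \<omega> \<le> u i}" "U (Suc j)" "q * G j l - d"]
      events[of j u] U[of "Suc j"] atomless[of "Suc j"] Suc.prems(1)
    by (auto simp: G_Suc) (auto simp: G_def)
  \<comment> \<open>Whatever the constraint on the last coordinate, the additional mass is contained
    in the difference of the two boxes in the first \<open>j\<close> coordinates.\<close>
  have increment: "G (Suc j) (u(Suc j := t)) - G (Suc j) (l(Suc j := t)) \<le> G j u - G j l" for t
  proof -
    let ?A = "\<lambda>x. {\<omega> \<in> space M. \<forall>i\<in>{1..j}. U i \<omega> \<le> x i}"
    have sub: "?A l \<subseteq> ?A u"
      using lu by (auto intro: order_trans)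
    have ev: "?A l \<in> events" "?A u \<in> events" "{\<omega> \<in> ?A l. U (Suc j) \<omega> \<le> t} \<in> events"
      using events[of j] Suc.prems(1) U[of "Suc j"] by auto
    have "prob {\<omega> \<in> ?A u. U (Suc j) \<omega> \<le> t} \<le> prob ({\<omega> \<in> ?A l. U (Suc j) \<omega> \<le> t} \<union> (?A u - ?A l))"
      using ev by (intro finite_measure_mono) auto
    also have "\<dots> \<le> prob {\<omega> \<in> ?A l. U (Suc j) \<omega> \<le> t} + prob (?A u - ?A l)"
      using ev by (intro measure_Un_le) auto
    also have "prob (?A u - ?A l) = G j u - G j l"
      unfolding G_def using ev sub by (intro finite_measure_Diff) auto
    finally show ?thesis
      by (simp add: G_Suc)
  qed
  \<comment> \<open>Otherwise monotonicity would put the level \<open>q * G j u + d\<close> below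
    the level \<open>q * G j l - d\<close>.\<close>
  have "l' \<le> u'"
  proof (rule ccontr)
    assume "\<not> l' \<le> u'"
    then have "G (Suc j) (l(Suc j := u')) \<le> G (Suc j) (u(Suc j := l'))"
      using lu Suc.prems(1) by (intro G_mono) auto
    moreover have "q * G j l \<le> q * G j u"
      using G_mono[of j l u] lu q Suc.prems(1) by simp
    ultimately show False
      using u' l' \<open>0 < d\<close> by linarith
  qed
  have shift: "G (Suc j) (l(Suc j := t)) \<le> G (Suc j) (u(Suc j := t))" for t
    using lu Suc.prems(1) by (intro G_mono) auto
  have Gu: "q * G j u \<le> G (Suc j) (u(Suc j := u'))" "G (Suc j) (u(Suc j := u')) \<le> q * G j u + 2 * d"
    using shift[of u'] u' increment[of u'] diff \<open>0 < d\<close>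
    by auto
  have Gl: "G (Suc j) (l(Suc j := l')) \<le> q * G j l" "q * G j l - 2 * d \<le> G (Suc j) (l(Suc j := l'))"
    using shift[of l'] l' increment[of l'] diff \<open>0 < d\<close>
    by auto
  \<comment> \<open>This \<open>d\<close> and the two errors \<open>2 * d\<close> above give a new
    width of at most \<open>5 * d\<close>, strictly below \<open>6 * d \<le> e\<close>; hence the
    \<open>e / 6\<close> in \<open>d\<close>.\<close>
  have "q * (G j u - G j l) \<le> 1 * d"
    using q diff \<open>0 < d\<close> G_mono[of j l u] lu Suc.prems(1) by (intro mult_mono) auto
  then have "G (Suc j) (u(Suc j := u')) - G (Suc j) (l(Suc j := l')) < e"
    using Gu Gl d by (simp add: algebra_simps)
  moreover have "q * G j l \<le> q * q ^ j" "q * q ^ j \<le> q * G j u"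
    using lq qu q by auto
  then have "G (Suc j) (l(Suc j := l')) \<le> q ^ Suc j" "q ^ Suc j \<le> G (Suc j) (u(Suc j := u'))"
    using Gu Gl by auto
  moreover have "whp N (\<lambda>m B \<omega>. \<forall>i\<in>{1..Suc j}. ereal ((l(Suc j := l')) i) \<le> threshold_seq (s m \<omega>) B q i \<and>
      threshold_seq (s m \<omega>) B q i \<le> ereal ((u(Suc j := u')) i))"
  proof -
    \<comment> \<open>Both \<open>up\<close> and \<open>lo\<close> compare two empirical values, one
      of them multiplied by \<open>q < 1\<close>. Errors below \<open>d / 2\<close> in each
      therefore stay within the margin \<open>d\<close>.\<close>
    let ?near = "\<lambda>k x m B \<omega>. \<bar>joint_edf (s m \<omega>) B k x - G k x\<bar> < d / 2"
    have near: "whp N (?near k x)" if "k \<le> p" for k x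
      using edf[OF that, of "d / 2"] \<open>0 < d\<close> by simp
    have "whp N (\<lambda>m B \<omega>. (\<forall>i\<in>{1..j}.
        ereal (l i) \<le> threshold_seq (s m \<omega>) B q i \<and> threshold_seq (s m \<omega>) B q i \<le> ereal (u i)) \<and>
      (?near (Suc j) (l(Suc j := u')) m B \<omega> \<and> ?near j u m B \<omega>) \<and>
      ?near (Suc j) (u(Suc j := l')) m B \<omega> \<and> ?near j l m B \<omega>)"
      using Suc.prems(1) by (intro whp_conj N whp near) auto
    then show ?thesis
    proof (rule whp_mono)
      fix m B \<omega>
      assume *: "(\<forall>i\<in>{1..j}.
          ereal (l i) \<le> threshold_seq (s m \<omega>) B q i \<and> threshold_seq (s m \<omega>) B q i \<le> ereal (u i)) \<and>
        (?near (Suc j) (l(Suc j := u')) m B \<omega> \<and> ?near j u m B \<omega>) \<and>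
        ?near (Suc j) (u(Suc j := l')) m B \<omega> \<and> ?near j l m B \<omega>"
      have n: "joint_edf (s m \<omega>) B j u < G j u + d / 2" "G j l - d / 2 < joint_edf (s m \<omega>) B j l"
          "q * G j u + d / 2 < joint_edf (s m \<omega>) B (Suc j) (l(Suc j := u'))"
          "joint_edf (s m \<omega>) B (Suc j) (u(Suc j := l')) < q * G j l - d / 2"
        using * unfolding u' l' by linarith+
      have qd: "q * (d / 2) < d / 2"
        using q \<open>0 < d\<close> by simp
      have "q * joint_edf (s m \<omega>) B j u < q * (G j u + d / 2)"
        by (rule mult_strict_left_mono[OF n(1) q(1)])
      also have "\<dots> < q * G j u + d / 2"
        using qd by (simp add: algebra_simps)
      also have "\<dots> < joint_edf (s m \<omega>) B (Suc j) (l(Suc j := u'))"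
        by (rule n(3))
      finally have up: "q * joint_edf (s m \<omega>) B j u < joint_edf (s m \<omega>) B (Suc j) (l(Suc j := u'))" .
      have "joint_edf (s m \<omega>) B (Suc j) (u(Suc j := l')) < q * G j l - d / 2"
        by (rule n(4))
      also have "\<dots> < q * (G j l - d / 2)"
        using qd by (simp add: algebra_simps)
      also have "\<dots> < q * joint_edf (s m \<omega>) B j l"
        by (rule mult_strict_left_mono[OF n(2) q(1)])
      finally have lo: "joint_edf (s m \<omega>) B (Suc j) (u(Suc j := l')) < q * joint_edf (s m \<omega>) B j l" .
      have "ereal l' \<le> threshold_seq (s m \<omega>) B q (Suc j)" "threshold_seq (s m \<omega>) B q (Suc j) \<le> ereal u'"
        by (rule threshold_seq_between[OF _ \<open>0 < q\<close> up lo]; use * in blast)+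
      with * show "\<forall>i\<in>{1..Suc j}. ereal ((l(Suc j := l')) i) \<le> threshold_seq (s m \<omega>) B q i \<and>
          threshold_seq (s m \<omega>) B q i \<le> ereal ((u(Suc j := u')) i)"
        by (auto simp: le_Suc_eq)
    qed
  qed
  moreover have "(l(Suc j := l')) i \<le> (u(Suc j := u')) i" for i
    using lu \<open>l' \<le> u'\<close> by simp
  ultimately show ?case
    by blast
qed

section \<open>Suprema over the sub-intervals\<close>

lemma sub_interval_subset:
  assumes "0 < T" "i \<in> {1..p}"
  shows "sub_interval T p i \<subseteq> {1..T + 1}"
proof -
  have "grid T p i \<le> T + 1" "1 \<le> grid T p (i - 1)"
    using assms by (auto simp: grid_def field_simps)
  then show ?thesis
    by (auto simp: sub_interval_def)
qed

lemma sub_interval_nonempty: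
  assumes "0 < T" "i \<in> {1..p}"
  shows "sub_interval T p i \<noteq> {}"
proof -
  have "grid T p (i - 1) < grid T p i"
    using assms by (auto simp: grid_def field_simps of_nat_diff)
  then show ?thesis
    by (auto simp: sub_interval_def)
qed

lemma sub_interval_cover:
  assumes "0 < T" "1 \<le> p" "t \<in> {1..T + 1}"
  shows "\<exists>!i. i \<in> {1..p} \<and> t \<in> sub_interval T p i"
proof -
  \<comment> \<open>The index sought is the successor of the largest element. Requiring
    \<open>i < p\<close> sends the end point \<open>T + 1\<close> to the last interval, the closed
    one.\<close>
  define I where "I = {i. i < p \<and> grid T p i \<le> t}"
  have grid_mono: "grid T p i \<le> grid T p k" if "i \<le> k" for i k
    using that assms by (auto simp: grid_def intro!: divide_right_mono)
  have p: "grid T p p = T + 1"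
    using assms by (simp add: grid_def)
  have "finite I" "0 \<in> I"
    using assms by (auto simp: I_def grid_def)
  have I: "i < p" "grid T p i \<le> t" if "i \<in> I" for i
    using that by (auto simp: I_def)
  from \<open>finite I\<close> \<open>0 \<in> I\<close> have Max: "Max I \<in> I" "\<And>i. i \<in> I \<Longrightarrow> i \<le> Max I"
    using Max_in[of I] Max_ge[of I] by blast+
  show ?thesis
  proof (rule ex1I[of _ "Suc (Max I)"])
    have "t < grid T p (Suc (Max I))" if "Suc (Max I) \<noteq> p"
    proof (rule ccontr)
      assume "\<not> t < grid T p (Suc (Max I))"
      then have "Suc (Max I) \<in> I"
        using Max(1) that by (auto simp: I_def)
      then show False
        using Max(2) by fastforce
    qed
    then show "Suc (Max I) \<in> {1..p} \<and> t \<in> sub_interval T p (Suc (Max I))"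
      using I[OF Max(1)] assms(3) p by (auto simp: sub_interval_def)
  next
    fix i assume i: "i \<in> {1..p} \<and> t \<in> sub_interval T p i"
    then have "i - 1 \<in> I"
      by (auto simp: I_def sub_interval_def split: if_splits)
    moreover have "Max I \<le> i - 1"
    proof (rule ccontr)
      assume "\<not> Max I \<le> i - 1"
      then have "i \<le> Max I" "i \<noteq> p"
        using i Max(1) by (auto simp: I_def)
      then show False
        using i Max(1) grid_mono[of i "Max I"] by (auto simp: I_def sub_interval_def)
    qed
    ultimately show "i = Suc (Max I)"
      using Max(2)[of "i - 1"] i by auto
  qed
qed

lemma mspace_linf: "f \<in> mspace (linf S) \<longleftrightarrow> f \<in> extensional S \<and> bounded (f ` S)"
  by (auto simp: linf_def Met_TC.fspace_def )

lemma abs_diff_le_mdist_linf: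
  assumes "f \<in> mspace (linf S)" "g \<in> mspace (linf S)" "t \<in> S"
  shows "\<bar>f t - g t\<bar> \<le> mdist (linf S) f g"
  using assms Met_TC.funspace_mdist_le[of f S g "mdist (linf S) f g"]
  by (auto simp: linf_def dist_real_def)

text \<open>Boundedness ensures that the real supremum is a true least upper bound; nonemptiness of
  the sub-interval settles the case \<open>c = -\<infinity>\<close>, where both sides fail.\<close>

lemma sup_on_le_iff:
  assumes "0 < T" "i \<in> {1..p}" "bounded (f ` {1..T + 1})"
  shows "ereal (sup_on T p i f) \<le> c \<longleftrightarrow> (\<forall>t\<in>sub_interval T p i. ereal (f t) \<le> c)"
proof -
  have "bdd_above (f ` sub_interval T p i)"
    using assms sub_interval_subset[OF assms(1,2)] 
    by (meson bounded_imp_bdd_above bounded_subset image_mono)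
  then show ?thesis
    using sub_interval_nonempty[OF assms(1,2)]
    by (cases c) (auto simp: sup_on_def cSUP_le_iff)
qed

text \<open>A supremum moves by at most the uniform distance, so the constant is 1. The resulting
  continuity carries weak convergence in \<open>linf\<close> over to the suprema.\<close>

lemma Lipschitz_sup_on:
  assumes "0 < T" "i \<in> {1..p}"
  shows "Lipschitz_continuous_map (linf {1..T + 1}) euclidean_metric (sup_on T p i)"
proof -
  have "sup_on T p i f \<le> sup_on T p i g + mdist (linf {1..T + 1}) f g"
    if "f \<in> mspace (linf {1..T + 1})" "g \<in> mspace (linf {1..T + 1})" for f g
  proof -
    have "f t \<le> sup_on T p i g + mdist (linf {1..T + 1}) f g" if "t \<in> sub_interval T p i" for t
    proof -
      have "ereal (g t) \<le> ereal (sup_on T p i g)"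
        using sup_on_le_iff[OF assms, of g "ereal (sup_on T p i g)"] \<open>g \<in> _\<close> that
        by (auto simp: mspace_linf)
      then show ?thesis
        using abs_diff_le_mdist_linf[of f "{1..T + 1}" g t] \<open>f \<in> _\<close> \<open>g \<in> _\<close>
          sub_interval_subset[OF assms] that by auto
    qed
    then show ?thesis
      using sup_on_le_iff[OF assms, of f "ereal (sup_on T p i g + mdist (linf {1..T + 1}) f g)"] that
      by (auto simp: mspace_linf)
  qed
  then show ?thesis
    unfolding Lipschitz_continuous_map_def
    by (auto simp: dist_real_def abs_le_iff algebra_simps mdist_commute intro!: exI[of _ 1]) (smt (verit) mdist_commute)+
qed

lemma continuous_map_sup_on:
  "0 < T \<Longrightarrow> i \<in> {1..p} \<Longrightarrow>
    continuous_map (mtopology_of (linf {1..T + 1})) euclideanreal (sup_on T p i)"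
  using Lipschitz_sup_on[THEN Lipschitz_continuous_imp_continuous_map] by simp

lemma space_borel_of: "space (borel_of \<T>) = topspace \<T>"
  unfolding borel_of_def by (rule space_measure_of) (auto dest: openin_subset)

lemma continuous_map_measurable_borel_of:
  assumes "continuous_map \<T> euclidean f"
  shows "f \<in> borel_of \<T> \<rightarrow>\<^sub>M borel"
proof (rule borel_measurableI)
  fix U :: "'b set" assume "open U"
  then have "openin \<T> {x \<in> topspace \<T>. f x \<in> U}"
    using assms by (auto simp: continuous_map_def)
  moreover have "f -` U \<inter> space (borel_of \<T>) = {x \<in> topspace \<T>. f x \<in> U}"
    by (auto simp: space_borel_of)
  moreover have "sets (borel_of \<T>) = sigma_sets (topspace \<T>) {U. openin \<T> U}"
    unfolding borel_of_def by (rule sets_measure_of) (auto dest: openin_subset)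
  ultimately show "f -` U \<inter> space (borel_of \<T>) \<in> sets (borel_of \<T>)"
    by auto
qed

text \<open>An integrable \<open>h\<close> is its own least majorant. Outer expectations thus become
  integrals as soon as \<open>V m\<close> enters through measurable real functionals.\<close>

lemma outer_expectation_eq_integral:
  assumes "integrable M h"
  shows "outer_expectation M h = integral\<^sup>L M h"
  unfolding outer_expectation_def
  by (rule cInf_eq_minimum) (use assms in \<open>auto intro!: integral_mono\<close>)

section \<open>Probabilities of boxes under weak convergence\<close>

lemma continuous_map_Max:
  assumes "finite A" "A \<noteq> {}" "\<And>a. a \<in> A \<Longrightarrow> continuous_map \<T> euclideanreal (f a)"
  shows "continuous_map \<T> euclideanreal (\<lambda>v. Max ((\<lambda>a. f a v) ` A))"
  using assms
proof (induction A rule: finite_ne_induct)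
  case (insert a A)
  then show ?case
    by (auto intro: continuous_map_real_max)
qed simp

text \<open>The maps \<open>V m\<close> may fail to be measurable, but the functionals
  \<open>f a\<close> of them are measurable, which brings the question back to ordinary
  distributions on the line. The boundary of the box is null in the limit since no coordinate has an
  atom at its bound.\<close>

lemma weakly_converges_box:
  fixes x :: "'i \<Rightarrow> real"
  assumes wc: "weakly_converges \<T> M V L Y"
    and L: "prob_space L" and M: "\<And>m. 1 \<le> m \<Longrightarrow> prob_space (M m)"
    and A': "finite A"
    and cont: "\<And>a. a \<in> A \<Longrightarrow> continuous_map \<T> euclideanreal (f a)"
    and meas: "\<And>a m. a \<in> A \<Longrightarrow> 1 \<le> m \<Longrightarrow> (\<lambda>\<omega>. f a (V m \<omega>)) \<in> borel_measurable (M m)"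
    and atomless: "\<And>a. a \<in> A \<Longrightarrow> \<P>(\<omega> in L. f a (Y \<omega>) = x a) = 0"
  shows "(\<lambda>m. \<P>(\<omega> in M m. \<forall>a\<in>A. f a (V m \<omega>) \<le> x a)) \<longlonglongrightarrow> \<P>(\<omega> in L. \<forall>a\<in>A. f a (Y \<omega>) \<le> x a)"
proof (cases "A = {}")
  case True
  then show ?thesis
    using prob_space.prob_space[OF L] prob_space.prob_space[OF M]
    by (intro tendsto_eventually eventually_sequentiallyI[of 1]) simp
next
  case False
  with A' have A: "finite A" "A \<noteq> {}"
    by simp_all
  interpret L: prob_space L by fact
  \<comment> \<open>The box is the event that the single real variable \<open>g\<close> is at most zero, so that weak convergence
    on the real line suffices.\<close>
  define g where "g v = Max ((\<lambda>a. f a v - x a) ` A)" for v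
  have g_le: "g v \<le> 0 \<longleftrightarrow> (\<forall>a\<in>A. f a v \<le> x a)" for v
    using A by (auto simp: g_def)
  have g: "continuous_map \<T> euclideanreal g"
    unfolding g_def using A cont by (intro continuous_map_Max continuous_map_diff) auto
  have Y: "Y \<in> L \<rightarrow>\<^sub>M borel_of \<T>"
    using wc by (simp add: weakly_converges_def)
  have fY: "(\<lambda>\<omega>. f a (Y \<omega>)) \<in> borel_measurable L" if "a \<in> A" for a
    using measurable_compose[OF Y continuous_map_measurable_borel_of[OF cont[OF that]]] .
  have gY: "(\<lambda>\<omega>. g (Y \<omega>)) \<in> borel_measurable L"
    using measurable_compose[OF Y continuous_map_measurable_borel_of[OF g]] .
  have gV: "(\<lambda>\<omega>. g (V m \<omega>)) \<in> borel_measurable (M m)" if "1 \<le> m" for m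
    unfolding g_def using A(1) meas[OF _ that]
    by (intro borel_measurable_Max borel_measurable_diff) auto
  \<comment> \<open>The index is shifted because the hypotheses on \<open>M m\<close> start at
    \<open>m = 1\<close>, whereas every member of the sequence has to be a probability
    distribution.\<close>
  define P where "P n = distr (M (Suc n)) borel (\<lambda>\<omega>. g (V (Suc n) \<omega>))" for n
  define Q where "Q = distr L borel (\<lambda>\<omega>. g (Y \<omega>))"
  have dP: "real_distribution (P n)" for n
    unfolding P_def using gV M by (intro prob_space.real_distribution_distr) auto
  have dQ: "real_distribution Q"
    unfolding Q_def using gY by (intro L.real_distribution_distr)
  \<comment> \<open>Continuous step functions suffice for weak convergence on the line, and composed
    with \<open>g\<close> they are bounded continuous test functions on \<open>\<T>\<close>.\<close>
  have "weak_conv_m P Q"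
  proof (rule integral_cts_step_conv_imp_weak_conv[OF dP dQ])
    fix a b :: real assume "a < b"
    have [measurable]: "cts_step a b \<in> borel_measurable borel"
      using cts_step_uniformly_continuous[OF \<open>a < b\<close>]
      by (intro borel_measurable_continuous_onI uniformly_continuous_imp_continuous)
    have range: "\<bar>cts_step a b t\<bar> \<le> 1" for t
      using \<open>a < b\<close> by (auto simp: cts_step_def)
    have "continuous_map \<T> euclideanreal (cts_step a b \<circ> g)"
      using uniformly_continuous_imp_continuous[OF cts_step_uniformly_continuous[OF \<open>a < b\<close>]]
      by (intro continuous_map_compose[OF g]) simp
    moreover have "bounded ((cts_step a b \<circ> g) ` topspace \<T>)"
      using range by (auto simp: bounded_iff intro!: exI[of _ 1])
    ultimately have "(\<lambda>m. outer_expectation (M m) (\<lambda>\<omega>. cts_step a b (g (V m \<omega>))))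
        \<longlonglongrightarrow> integral\<^sup>L L (\<lambda>\<omega>. cts_step a b (g (Y \<omega>)))"
      using wc by (fastforce simp: weakly_converges_def)
    then have "(\<lambda>n. outer_expectation (M (Suc n)) (\<lambda>\<omega>. cts_step a b (g (V (Suc n) \<omega>))))
        \<longlonglongrightarrow> integral\<^sup>L L (\<lambda>\<omega>. cts_step a b (g (Y \<omega>)))"
      by (rule LIMSEQ_Suc)
    moreover have "outer_expectation (M (Suc n)) (\<lambda>\<omega>. cts_step a b (g (V (Suc n) \<omega>))) =
        integral\<^sup>L (P n) (cts_step a b)" for n
    proof -
      interpret prob_space "M (Suc n)" by (rule M) simp
      have [measurable]: "(\<lambda>\<omega>. g (V (Suc n) \<omega>)) \<in> borel_measurable (M (Suc n))"
        by (rule gV) simp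
      have "integrable (M (Suc n)) (\<lambda>\<omega>. cts_step a b (g (V (Suc n) \<omega>)))"
        using range by (intro integrable_const_bound[of _ 1]) auto
      then show ?thesis
        by (simp add: outer_expectation_eq_integral P_def integral_distr)
    qed
    ultimately show "(\<lambda>n. integral\<^sup>L (P n) (cts_step a b)) \<longlonglongrightarrow> integral\<^sup>L Q (cts_step a b)"
      using gY by (simp add: Q_def integral_distr)
  qed
  moreover have "isCont (cdf Q) 0"
  proof -
    interpret Q: real_distribution Q by (rule dQ)
    have "measure Q {0} = \<P>(\<omega> in L. g (Y \<omega>) = 0)"
      using gY by (simp add: Q_def measure_distr vimage_def Int_def conj_commute)
    \<comment> \<open>A finite maximum is attained, so \<open>g = 0\<close> places some coordinate
      exactly at its bound.\<close>
    also have "\<dots> \<le> L.prob (\<Union>a\<in>A. {\<omega> \<in> space L. f a (Y \<omega>) = x a})"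
    proof (intro L.finite_measure_mono subsetI)
      fix \<omega> assume "\<omega> \<in> {\<omega> \<in> space L. g (Y \<omega>) = 0}"
      moreover have "g (Y \<omega>) \<in> (\<lambda>a. f a (Y \<omega>) - x a) ` A"
        unfolding g_def using A by (intro Max_in) auto
      ultimately show "\<omega> \<in> (\<Union>a\<in>A. {\<omega> \<in> space L. f a (Y \<omega>) = x a})"
        by auto
    qed (use A fY in auto)
    also have "\<dots> \<le> (\<Sum>a\<in>A. \<P>(\<omega> in L. f a (Y \<omega>) = x a))"
      using A fY by (intro L.finite_measure_subadditive_finite) auto
    also have "\<dots> = 0"
      using atomless by simp
    finally show ?thesis
      by (simp add: Q.isCont_cdf measure_le_0_iff)
  qed
  ultimately have "(\<lambda>n. cdf (P n) 0) \<longlonglongrightarrow> cdf Q 0"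
    by (simp add: weak_conv_m_def weak_conv_def)
  moreover have "cdf (P n) 0 = \<P>(\<omega> in M (Suc n). \<forall>a\<in>A. f a (V (Suc n) \<omega>) \<le> x a)" for n
    using gV[of "Suc n"] unfolding cdf_def P_def g_le[symmetric]
    by (subst measure_distr) (auto intro!: arg_cong[of _ _ "measure _"])
  moreover have "cdf Q 0 = \<P>(\<omega> in L. \<forall>a\<in>A. f a (Y \<omega>) \<le> x a)"
    using gY unfolding cdf_def Q_def g_le[symmetric]
    by (subst measure_distr) (auto intro!: arg_cong[of _ _ "measure _"])
  ultimately show ?thesis
    by (simp add: LIMSEQ_imp_Suc)
qed

text \<open>With the other coordinates cut off at \<open>n\<close>, the slice \<open>U k = c\<close>
  has probability at most the increment of the joint distribution function between a point just left
  of \<open>c\<close> and \<open>c\<close> in direction \<open>k\<close>; continuity sends this to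
  0. The slices exhaust the event as \<open>n\<close> grows.\<close>

lemma (in prob_space) atomless_of_continuous_joint_df:
  fixes U :: "nat \<Rightarrow> 'a \<Rightarrow> real"
  assumes U: "\<And>i. i \<in> I \<Longrightarrow> U i \<in> borel_measurable M" and "finite I" "k \<in> I"
    and cont: "continuous_map (powertop_real I) euclideanreal (\<lambda>x. \<P>(\<omega> in M. \<forall>i\<in>I. U i \<omega> \<le> x i))"
  shows "\<P>(\<omega> in M. U k \<omega> = c) = 0"
proof -
  define A where "A n = {\<omega> \<in> space M. U k \<omega> = c \<and> (\<forall>i\<in>I - {k}. U i \<omega> \<le> real n)}" for n
  have [measurable]: "A n \<in> events" for n
    unfolding A_def using U \<open>finite I\<close> \<open>k \<in> I\<close> by measurable
  have null: "prob (A n) = 0" for n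
  proof -
    define r where "r t = (\<lambda>i\<in>I. if i = k then t else real n)" for t
    define H where "H t = \<P>(\<omega> in M. \<forall>i\<in>I. U i \<omega> \<le> r t i)" for t
    have "continuous_map euclideanreal (powertop_real I) r"
      unfolding r_def by (subst continuous_map_componentwise) (auto simp: image_subset_iff)
    then have "continuous_map euclideanreal euclideanreal H"
      using continuous_map_compose[OF _ cont, of euclideanreal r] by (simp add: H_def comp_def)
    then have "isCont H c"
      by (simp add: continuous_on_eq_continuous_at)
    have "(\<lambda>m. H (c - inverse (real (Suc m)))) \<longlonglongrightarrow> H (c - 0)"
      using \<open>isCont H c\<close>
      by (intro isCont_tendsto_compose[of _ H] tendsto_intros LIMSEQ_inverse_real_of_nat) simp_all
    then have "(\<lambda>m. H c - H (c - inverse (real (Suc m)))) \<longlonglongrightarrow> H c - H (c - 0)"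
      by (intro tendsto_intros)
    moreover have "prob (A n) \<le> H c - H (c - inverse (real (Suc m)))" for m
    proof -
      let ?B = "\<lambda>t. {\<omega> \<in> space M. \<forall>i\<in>I. U i \<omega> \<le> r t i}"
      have ev: "?B t \<in> events" for t
        using U \<open>finite I\<close> by measurable
      have "r t k = t" for t
        using \<open>k \<in> I\<close> by (simp add: r_def)
      then have "A n \<inter> ?B (c - inverse (real (Suc m))) = {}"
        using \<open>k \<in> I\<close> by (fastforce simp: A_def)
      then have "prob (A n) + H (c - inverse (real (Suc m))) = prob (A n \<union> ?B (c - inverse (real (Suc m))))"
        unfolding H_def using ev by (subst finite_measure_Union) auto
      also have "\<dots> \<le> H c"
        unfolding H_def
      proof (rule finite_measure_mono)
        have "r (c - inverse (real (Suc m))) i \<le> r c i" if "i \<in> I" for i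
          using that by (simp add: r_def)
        then show "A n \<union> ?B (c - inverse (real (Suc m))) \<subseteq> ?B c"
          by (fastforce simp: A_def r_def intro: order_trans)
      qed (rule ev)
      finally show ?thesis
        by simp
    qed
    ultimately have "prob (A n) \<le> 0"
      by (intro LIMSEQ_le_const[of _ _ "prob (A n)"]) auto
    then show ?thesis
      by (simp add: measure_le_0_iff)
  qed
  have "incseq A"
    unfolding A_def incseq_def by (auto intro: order_trans)
  then have "(\<lambda>n. prob (A n)) \<longlonglongrightarrow> prob (\<Union>n. A n)"
    by (intro finite_Lim_measure_incseq) auto
  moreover have "(\<Union>n. A n) = {\<omega> \<in> space M. U k \<omega> = c}"
  proof -
    have "\<exists>n. \<forall>i\<in>I - {k}. U i \<omega> \<le> real n" for \<omega>
    proof -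
      obtain n where "(\<Sum>i\<in>I. \<bar>U i \<omega>\<bar>) \<le> real n"
        using real_arch_simple by blast
      moreover have "U i \<omega> \<le> (\<Sum>i\<in>I. \<bar>U i \<omega>\<bar>)" if "i \<in> I" for i
        using member_le_sum[of i I "\<lambda>i. \<bar>U i \<omega>\<bar>"] that \<open>finite I\<close> by auto
      ultimately show ?thesis
        by (meson DiffD1 order_trans)
    qed
    then show ?thesis
      by (auto simp: A_def)
  qed
  ultimately show ?thesis
    using null by (simp add: LIMSEQ_const_iff)
qed

section \<open>The sampling model\<close>

lemma floor_mult_mem_horizon:
  assumes "t \<in> {1..T + 1}"
  shows "nat \<lfloor>real m * t\<rfloor> \<in> {m..horizon T m}"
proof -
  have "real m * 1 \<le> real m * t" "real m * t \<le> real m * (T + 1)"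
    using assms by (intro mult_left_mono; simp)+
  then have "int m \<le> \<lfloor>real m * t\<rfloor>"
    by (simp add: le_floor_iff)
  moreover have "\<lfloor>real m * t\<rfloor> \<le> \<lfloor>real m * (T + 1)\<rfloor>"
    by (rule floor_mono) fact
  ultimately show ?thesis
    by (auto simp: horizon_def le_nat_iff nat_mono)
qed

lemma le_horizon: "0 < T \<Longrightarrow> m \<le> horizon T m"
  using floor_mult_mem_horizon[of 1 T m] by auto

lemma detector_fun_eq:
  "t \<in> {1..T + 1} \<Longrightarrow> detector_fun T \<delta> m x t =
    (if nat \<lfloor>real m * t\<rfloor> = m then 0 else \<delta> m (nat \<lfloor>real m * t\<rfloor>) (restrict x {1..nat \<lfloor>real m * t\<rfloor>}))"
  by (simp add: detector_fun_def Let_def)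

text \<open>A step function of \<open>t\<close>, with at most one value per index in
  \<open>{m..horizon T m}\<close>.\<close>

lemma bounded_detector_fun: "bounded (detector_fun T \<delta> m x ` {1..T + 1})"
proof (rule finite_imp_bounded, rule finite_subset)
  show "detector_fun T \<delta> m x ` {1..T + 1} \<subseteq>
      (\<lambda>k. if k = m then 0 else \<delta> m k (restrict x {1..k})) ` {m..horizon T m}"
    using floor_mult_mem_horizon[of _ T m] by (force simp: detector_fun_eq)
qed simp

lemma sampling_modelD:
  assumes "sampling_model T R M X W" "1 \<le> m"
  shows "prob_space (M m)"
    and "\<And>i. i \<in> {1..horizon T m} \<Longrightarrow> X m i \<in> borel_measurable (M m)"
    and "prob_space.indep_vars (M m) (\<lambda>_. R m) (W m) {1..}"
    and "\<And>b. 1 \<le> b \<Longrightarrow> W m b \<in> M m \<rightarrow>\<^sub>M R m"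
    and "\<And>b. 1 \<le> b \<Longrightarrow> distr (M m) (R m) (W m b) = R m"
    and "\<And>k. k \<le> horizon T m \<Longrightarrow>
      (\<lambda>\<omega>. restrict (\<lambda>i. X m i \<omega>) {1..k}) \<in> M m \<rightarrow>\<^sub>M Pi\<^sub>M {1..k} (\<lambda>_. borel)"
proof -
  show M: "prob_space (M m)"
    and X: "\<And>i. i \<in> {1..horizon T m} \<Longrightarrow> X m i \<in> borel_measurable (M m)"
    and W: "prob_space.indep_vars (M m) (\<lambda>_. R m) (W m) {1..}"
    and "\<And>b. 1 \<le> b \<Longrightarrow> distr (M m) (R m) (W m b) = R m"
    using assms by (auto simp: sampling_model_def)
  show "W m b \<in> M m \<rightarrow>\<^sub>M R m" if "1 \<le> b" for b
    using W that by (simp add: prob_space.indep_vars_def[OF M])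
  show "(\<lambda>\<omega>. restrict (\<lambda>i. X m i \<omega>) {1..k}) \<in> M m \<rightarrow>\<^sub>M Pi\<^sub>M {1..k} (\<lambda>_. borel)"
    if "k \<le> horizon T m" for k
    using that by (intro measurable_restrict X) auto
qed

text \<open>The supremum over an interval is one over the finite set \<open>K\<close> of indices
  that the interval visits.\<close>

lemma sup_on_detector_measurable:
  assumes "0 < T" and \<delta>: "detector_statistics T \<delta>" and model: "sampling_model T R M X W"
    and "1 \<le> m" "i \<in> {1..p}"
  shows "(\<lambda>\<omega>. sup_on T p i (detector_fun T \<delta> m (\<lambda>j. X m j \<omega>))) \<in> borel_measurable (M m)"
proof -
  define D where "D k \<omega> = (if k = m then 0 else \<delta> m k (restrict (\<lambda>j. X m j \<omega>) {1..k}))" for k \<omega>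
  define K where "K = (\<lambda>t. nat \<lfloor>real m * t\<rfloor>) ` sub_interval T p i"
  have K: "K \<subseteq> {m..horizon T m}"
    using floor_mult_mem_horizon sub_interval_subset[OF assms(1,5)] by (auto simp: K_def simp del: atLeastAtMost_iff)
  then have "finite K"
    by (rule finite_subset) simp
  have D: "D k \<in> borel_measurable (M m)" if "k \<in> K" for k
  proof (cases "k = m")
    case False
    with that K \<open>1 \<le> m\<close> \<delta> have "\<delta> m k \<in> borel_measurable (Pi\<^sub>M {1..k} (\<lambda>_. borel))" "k \<le> horizon T m"
      by (auto simp: detector_statistics_def subset_eq)
    then show ?thesis
      using False measurable_compose[OF sampling_modelD(6)[OF model \<open>1 \<le> m\<close>]] by (simp add: D_def[abs_def])
  qed (simp add: D_def[abs_def])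
  have "sup_on T p i (detector_fun T \<delta> m (\<lambda>j. X m j \<omega>)) = (SUP k\<in>K. D k \<omega>)" for \<omega>
    using sub_interval_subset[OF assms(1,5)] unfolding sup_on_def K_def image_image
    by (intro SUP_cong refl) (auto simp: detector_fun_eq D_def)
  moreover have "(\<lambda>\<omega>. SUP k\<in>K. D k \<omega>) \<in> borel_measurable (M m)"
    using \<open>finite K\<close> D by (intro borel_measurable_cSUP) (auto intro: countable_finite)
  ultimately show ?thesis
    by simp
qed

text \<open>Both sides are images of the laws of the longer stretch under the same projection. This
  brings H0 to the form in which the learning sample also enters the claim on the
  alternative.\<close>

lemma stretch_law_cong:
  fixes X :: "nat \<Rightarrow> nat \<Rightarrow> 'a \<Rightarrow> 'v::topological_space"
  assumes "0 < T" "sampling_model T R M X W" "1 \<le> m" "stationary_series S Z"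
    and "stretch_law (M m) (X m) (horizon T m) = stretch_law S Z (horizon T m)"
  shows "stretch_law (M m) (X m) m = stretch_law S Z m"
proof -
  have proj: "stretch_law N Y m = distr (stretch_law N Y (horizon T m)) (Pi\<^sub>M {1..m} (\<lambda>_. borel))
      (\<lambda>x. restrict x {1..m})"
    if "\<And>i. i \<in> {1..horizon T m} \<Longrightarrow> Y i \<in> borel_measurable N" for N :: "'x measure" and Y :: "nat \<Rightarrow> 'x \<Rightarrow> 'v"
    using le_horizon[OF assms(1), of m] that unfolding stretch_law_def
    by (subst distr_distr)
       (auto simp: comp_def restrict_restrict Int_absorb1 Int_absorb2 intro!: measurable_restrict measurable_restrict_subset)
  show ?thesis
    using assms proj[of "X m" "M m"] proj[of Z S] sampling_modelD(2)[OF assms(2,3)]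
    by (simp add: stationary_series_def)
qed

text \<open>Independence appears as in \<open>sampling_model\<close>, through families of preimages,
  since the two variables have different types. Rectangles determine a product of sigma-finite
  measures.\<close>

lemma (in prob_space) distr_pair_eq_of_indep_set:
  assumes X: "X \<in> M \<rightarrow>\<^sub>M N" and Y: "Y \<in> M \<rightarrow>\<^sub>M K"
    and indep: "indep_set {X -` A \<inter> space M |A. A \<in> sets N} {Y -` A \<inter> space M |A. A \<in> sets K}"
  shows "distr M (N \<Otimes>\<^sub>M K) (\<lambda>\<omega>. (X \<omega>, Y \<omega>)) = distr M N X \<Otimes>\<^sub>M distr M K Y"
proof (rule pair_measure_eqI[symmetric])
  show "sigma_finite_measure (distr M N X)" "sigma_finite_measure (distr M K Y)"
    using prob_space_distr[OF X] prob_space_distr[OF Y]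
    by (auto intro: finite_measure.axioms(1) prob_space.finite_measure)
  show "sets (distr M N X \<Otimes>\<^sub>M distr M K Y) = sets (distr M (N \<Otimes>\<^sub>M K) (\<lambda>\<omega>. (X \<omega>, Y \<omega>)))"
    by (simp cong: sets_pair_measure_cong)
  fix A B assume "A \<in> sets (distr M N X)" "B \<in> sets (distr M K Y)"
  then have AB: "A \<in> sets N" "B \<in> sets K"
    by simp_all
  have "emeasure (distr M (N \<Otimes>\<^sub>M K) (\<lambda>\<omega>. (X \<omega>, Y \<omega>))) (A \<times> B) =
      emeasure M ((X -` A \<inter> space M) \<inter> (Y -` B \<inter> space M))"
    using AB X Y by (subst emeasure_distr) (auto intro!: arg_cong[of _ _ "emeasure M"])
  also have "prob ((X -` A \<inter> space M) \<inter> (Y -` B \<inter> space M)) = prob (X -` A \<inter> space M) * prob (Y -` B \<inter> space M)"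
    using AB by (intro indep_setD[OF indep]) auto
  then have "emeasure M ((X -` A \<inter> space M) \<inter> (Y -` B \<inter> space M)) =
      emeasure M (X -` A \<inter> space M) * emeasure M (Y -` B \<inter> space M)"
    by (simp add: emeasure_eq_measure ennreal_mult)
  finally show "emeasure (distr M N X) A * emeasure (distr M K Y) B =
      emeasure (distr M (N \<Otimes>\<^sub>M K) (\<lambda>\<omega>. (X \<omega>, Y \<omega>))) (A \<times> B)"
    using AB X Y by (simp add: emeasure_distr)
qed

text \<open>The right-hand side involves neither \<open>b\<close> and \<open>b'\<close> nor the
  observations after the learning sample. The former gives exchangeability of the replicates, the
  latter the transfer to the alternative.\<close>

lemma replicate_pair_law:
  fixes X :: "nat \<Rightarrow> nat \<Rightarrow> 'a \<Rightarrow> 'v::topological_space"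
  assumes "0 < T" and model: "sampling_model T R M X W" and "1 \<le> m" "1 \<le> b" "1 \<le> b'" "b \<noteq> b'"
  shows "distr (M m) (Pi\<^sub>M {1..m} (\<lambda>_. borel) \<Otimes>\<^sub>M (R m \<Otimes>\<^sub>M R m))
      (\<lambda>\<omega>. (restrict (\<lambda>i. X m i \<omega>) {1..m}, W m b \<omega>, W m b' \<omega>)) =
    stretch_law (M m) (X m) m \<Otimes>\<^sub>M (R m \<Otimes>\<^sub>M R m)"
proof -
  let ?n = "horizon T m"
  let ?X = "\<lambda>\<omega>. restrict (\<lambda>i. X m i \<omega>) {1..?n}" and ?W = "\<lambda>\<omega>. \<lambda>b\<in>{1..}. W m b \<omega>"
  interpret prob_space "M m"
    by (rule sampling_modelD(1)[OF model \<open>1 \<le> m\<close>])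
  have indep: "indep_set {?X -` A \<inter> space (M m) |A. A \<in> sets (Pi\<^sub>M {1..?n} (\<lambda>_. borel))}
      {?W -` A \<inter> space (M m) |A. A \<in> sets (Pi\<^sub>M {1..} (\<lambda>_. R m))}"
    using model \<open>1 \<le> m\<close> by (simp add: sampling_model_def)
  have W: "W m b \<in> M m \<rightarrow>\<^sub>M R m" if "1 \<le> b" for b
    by (rule sampling_modelD(4)[OF model \<open>1 \<le> m\<close> that])
  have X: "(\<lambda>\<omega>. restrict (\<lambda>i. X m i \<omega>) {1..m}) \<in> M m \<rightarrow>\<^sub>M Pi\<^sub>M {1..m} (\<lambda>_. borel)"
    by (rule sampling_modelD(6)[OF model \<open>1 \<le> m\<close> le_horizon[OF \<open>0 < T\<close>]])
  have WW: "(\<lambda>\<omega>. (W m b \<omega>, W m b' \<omega>)) \<in> M m \<rightarrow>\<^sub>M R m \<Otimes>\<^sub>M R m"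
    using W assms by (intro measurable_Pair) auto
  have "distr (M m) (Pi\<^sub>M {1..m} (\<lambda>_. borel) \<Otimes>\<^sub>M (R m \<Otimes>\<^sub>M R m))
      (\<lambda>\<omega>. (restrict (\<lambda>i. X m i \<omega>) {1..m}, W m b \<omega>, W m b' \<omega>)) =
    distr (M m) (Pi\<^sub>M {1..m} (\<lambda>_. borel)) (\<lambda>\<omega>. restrict (\<lambda>i. X m i \<omega>) {1..m})
      \<Otimes>\<^sub>M distr (M m) (R m \<Otimes>\<^sub>M R m) (\<lambda>\<omega>. (W m b \<omega>, W m b' \<omega>))"
  proof (rule distr_pair_eq_of_indep_set[OF X WW], rule indep_setI; safe?)
    fix A B
    assume A: "A \<in> sets (Pi\<^sub>M {1..m} (\<lambda>_. borel :: 'v measure))" and B: "B \<in> sets (R m \<Otimes>\<^sub>M R m)"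
    \<comment> \<open>Independence is assumed for the full sample and the full sequence of sources,
      so events on the learning sample and on two sources are first pulled back to those
      spaces.\<close>
    define A' where "A' = (\<lambda>x. restrict x {1..m}) -` A \<inter> space (Pi\<^sub>M {1..?n} (\<lambda>_. borel :: 'v measure))"
    define B' where "B' = (\<lambda>w. (w b, w b')) -` B \<inter> space (Pi\<^sub>M {1..} (\<lambda>_. R m))"
    have "A' \<in> sets (Pi\<^sub>M {1..?n} (\<lambda>_. borel))"
      unfolding A'_def using le_horizon[OF \<open>0 < T\<close>, of m] A
      by (intro measurable_sets[OF measurable_restrict_subset]) auto
    moreover have "B' \<in> sets (Pi\<^sub>M {1..} (\<lambda>_. R m))"
      unfolding B'_def using B assms
      by (intro measurable_sets[OF measurable_Pair] measurable_component_singleton) auto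
    ultimately have "prob ((?X -` A' \<inter> space (M m)) \<inter> (?W -` B' \<inter> space (M m))) =
        prob (?X -` A' \<inter> space (M m)) * prob (?W -` B' \<inter> space (M m))"
      by (intro indep_setD[OF indep]) auto
    moreover have "?X -` A' \<inter> space (M m) = (\<lambda>\<omega>. restrict (\<lambda>i. X m i \<omega>) {1..m}) -` A \<inter> space (M m)"
      using le_horizon[OF \<open>0 < T\<close>, of m]
      by (auto simp: A'_def space_PiM Int_absorb1 restrict_restrict Int_commute)
    moreover have "?W -` B' \<inter> space (M m) = (\<lambda>\<omega>. (W m b \<omega>, W m b' \<omega>)) -` B \<inter> space (M m)"
      using assms measurable_space[OF W] by (auto simp: B'_def space_PiM)
    ultimately show "prob (((\<lambda>\<omega>. restrict (\<lambda>i. X m i \<omega>) {1..m}) -` A \<inter> space (M m)) \<inter>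
          ((\<lambda>\<omega>. (W m b \<omega>, W m b' \<omega>)) -` B \<inter> space (M m))) =
        prob ((\<lambda>\<omega>. restrict (\<lambda>i. X m i \<omega>) {1..m}) -` A \<inter> space (M m)) *
        prob ((\<lambda>\<omega>. (W m b \<omega>, W m b' \<omega>)) -` B \<inter> space (M m))"
      by simp
  qed (use measurable_sets[OF X] measurable_sets[OF WW] in auto)
  moreover have "indep_var (R m) (W m b) (R m) (W m b')"
  proof -
    have "indep_vars (\<lambda>_. R m) (W m) {b, b'}"
      using indep_vars_subset[OF sampling_modelD(3)[OF model \<open>1 \<le> m\<close>], of "{b, b'}"] assms by auto
    from indep_var_restrict[OF this, of "{b}" "{b'}"] \<open>b \<noteq> b'\<close>
    have "indep_var (Pi\<^sub>M {b} (\<lambda>_. R m)) (\<lambda>\<omega>. restrict (\<lambda>i. W m i \<omega>) {b})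
        (Pi\<^sub>M {b'} (\<lambda>_. R m)) (\<lambda>\<omega>. restrict (\<lambda>i. W m i \<omega>) {b'})"
      by simp
    from indep_var_compose[OF this, of "\<lambda>w. w b" "R m" "\<lambda>w. w b'" "R m"] show ?thesis
      by (simp add: comp_def)
  qed
  then have "distr (M m) (R m \<Otimes>\<^sub>M R m) (\<lambda>\<omega>. (W m b \<omega>, W m b' \<omega>)) = R m \<Otimes>\<^sub>M R m"
    using sampling_modelD(5)[OF model \<open>1 \<le> m\<close>] assms by (simp add: indep_var_distribution_eq)
  ultimately show ?thesis
    by (simp add: stretch_law_def)
qed

text \<open>The sub-intervals partition the monitoring period, so the definite description in
  \<open>threshold_fun\<close> denotes the interval containing \<open>t\<close>.\<close>

lemma no_exceedance_iff:
  assumes "0 < T" "1 \<le> p"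
  shows "(\<forall>t\<in>{1..T + 1}. ereal (detector_fun T \<delta> m x t) \<le> threshold_fun T p \<alpha> \<Phi> m B x w t) \<longleftrightarrow>
    (\<forall>i\<in>{1..p}. below_threshold T p \<alpha> \<delta> \<Phi> m B x w i)"
proof -
  have threshold: "threshold_fun T p \<alpha> \<Phi> m B x w t = threshold T p \<alpha> \<Phi> m B x w i"
    if "i \<in> {1..p}" "t \<in> sub_interval T p i" for t i
  proof -
    have t: "t \<in> {1..T + 1}"
      using sub_interval_subset[OF \<open>0 < T\<close> that(1)] that(2) by auto
    have "(THE i. i \<in> {1..p} \<and> t \<in> sub_interval T p i) = i"
      using sub_interval_cover[OF assms t] that by (intro the1_equality) auto
    with t show ?thesis
      by (simp add: threshold_fun_def)
  qed
  have "(\<forall>t\<in>{1..T + 1}. ereal (detector_fun T \<delta> m x t) \<le> threshold_fun T p \<alpha> \<Phi> m B x w t) \<longleftrightarrow>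
      (\<forall>i\<in>{1..p}. \<forall>t\<in>sub_interval T p i. ereal (detector_fun T \<delta> m x t) \<le> threshold_fun T p \<alpha> \<Phi> m B x w t)"
    using sub_interval_cover[OF assms] sub_interval_subset[OF \<open>0 < T\<close>] by blast
  also have "\<dots> \<longleftrightarrow> (\<forall>i\<in>{1..p}. below_threshold T p \<alpha> \<delta> \<Phi> m B x w i)"
    using threshold
    by (auto simp: below_threshold_def sup_on_le_iff[OF \<open>0 < T\<close> _ bounded_detector_fun])
  finally show ?thesis .
qed

lemma sup_on_replicate_measurable:
  assumes "0 < T" and \<Phi>: "replicate_map T p R \<Phi>" and model: "sampling_model T R M X W"
    and "1 \<le> m" "1 \<le> b" "i \<in> {1..p}"
  shows "(\<lambda>\<omega>. sup_on T p i (replicate_fun \<Phi> m (\<lambda>k. X m k \<omega>) (W m b \<omega>))) \<in> borel_measurable (M m)"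
proof -
  have "(\<lambda>\<omega>. (restrict (\<lambda>k. X m k \<omega>) {1..m}, W m b \<omega>)) \<in> M m \<rightarrow>\<^sub>M Pi\<^sub>M {1..m} (\<lambda>_. borel) \<Otimes>\<^sub>M R m"
    using le_horizon[OF \<open>0 < T\<close>] assms
    by (intro measurable_Pair sampling_modelD(6)[OF model] sampling_modelD(4)[OF model]) auto
  moreover have "(\<lambda>(x, w). sup_on T p i (\<Phi> m x w)) \<in> borel_measurable (Pi\<^sub>M {1..m} (\<lambda>_. borel) \<Otimes>\<^sub>M R m)"
    using \<Phi> assms by (auto simp: replicate_map_def)
  ultimately show ?thesis
    unfolding replicate_fun_def by (drule_tac measurable_compose) (assumption, simp)
qed

lemma below_threshold_measurable:
  assumes "0 < T" and \<delta>: "detector_statistics T \<delta>" and \<Phi>: "replicate_map T p R \<Phi>"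
    and model: "sampling_model T R M X W" and "1 \<le> m" "i \<in> {1..p}"
  shows "{\<omega> \<in> space (M m). below_threshold T p \<alpha> \<delta> \<Phi> m B (\<lambda>k. X m k \<omega>) (\<lambda>b. W m b \<omega>) i} \<in> sets (M m)"
  unfolding below_threshold_def threshold_def
proof (intro borel_measurable_le)
  show "(\<lambda>\<omega>. ereal (sup_on T p i (detector_fun T \<delta> m (\<lambda>k. X m k \<omega>)))) \<in> borel_measurable (M m)"
    using sup_on_detector_measurable[OF \<open>0 < T\<close> \<delta> model assms(5,6)] by simp
  show "(\<lambda>\<omega>. threshold_seq (\<lambda>b i. sup_on T p i (replicate_fun \<Phi> m (\<lambda>k. X m k \<omega>) (W m b \<omega>))) B
      ((1 - \<alpha>) powr (1 / real p)) i) \<in> borel_measurable (M m)"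
    using assms by (intro threshold_seq_measurable[of B p] sup_on_replicate_measurable[OF \<open>0 < T\<close> \<Phi> model]) auto
qed

text \<open>The limits are available under \<open>M\<close>, where H0 holds, but the conclusion is
  also needed under an alternative \<open>N\<close>. Both models give the learning sample together
  with two sources of randomness the same law \<open>\<mu> m\<close>, so events on one or two
  replicates have equal probabilities in both.\<close>

lemma joint_edf_replicates_whp:
  fixes X :: "nat \<Rightarrow> nat \<Rightarrow> 'a \<Rightarrow> 'v::topological_space"
  assumes "0 < T" and \<Phi>: "replicate_map T p R \<Phi>"
    and model: "sampling_model T R M X W" and model': "sampling_model T R N Y V"
    and law: "\<And>m. 1 \<le> m \<Longrightarrow> stretch_law (N m) (Y m) m = stretch_law (M m) (X m) m"
    and "j \<le> p" "0 < \<eta>"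
    and lim1: "(\<lambda>m. \<P>(\<omega> in M m. \<forall>i\<in>{1..j}.
      sup_on T p i (replicate_fun \<Phi> m (\<lambda>k. X m k \<omega>) (W m 1 \<omega>)) \<le> x i)) \<longlonglongrightarrow> c"
    and lim2: "(\<lambda>m. \<P>(\<omega> in M m.
      (\<forall>i\<in>{1..j}. sup_on T p i (replicate_fun \<Phi> m (\<lambda>k. X m k \<omega>) (W m 1 \<omega>)) \<le> x i) \<and>
      (\<forall>i\<in>{1..j}. sup_on T p i (replicate_fun \<Phi> m (\<lambda>k. X m k \<omega>) (W m 2 \<omega>)) \<le> x i))) \<longlonglongrightarrow> c\<^sup>2"
  shows "whp N (\<lambda>m B \<omega>. \<bar>joint_edf
    (\<lambda>b i. sup_on T p i (replicate_fun \<Phi> m (\<lambda>k. Y m k \<omega>) (V m b \<omega>))) B j x - c\<bar> < \<eta>)"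
proof -
  let ?S = "\<lambda>m. Pi\<^sub>M {1..m} (\<lambda>_. borel :: 'v measure) \<Otimes>\<^sub>M (R m \<Otimes>\<^sub>M R m)"
  define \<mu> where "\<mu> m = stretch_law (M m) (X m) m \<Otimes>\<^sub>M (R m \<Otimes>\<^sub>M R m)" for m
  define A1 where "A1 m = {z \<in> space (?S m). \<forall>i\<in>{1..j}. sup_on T p i (\<Phi> m (fst z) (fst (snd z))) \<le> x i}" for m
  define A2 where "A2 m = {z \<in> space (?S m). \<forall>i\<in>{1..j}. sup_on T p i (\<Phi> m (fst z) (snd (snd z))) \<le> x i}" for m
  have A: "A1 m \<in> sets (?S m)" "A2 m \<in> sets (?S m)" if "1 \<le> m" for m
  proof -
    have \<Phi>m: "(\<lambda>(x, w). sup_on T p i (\<Phi> m x w)) \<in> borel_measurable (Pi\<^sub>M {1..m} (\<lambda>_. borel) \<Otimes>\<^sub>M R m)"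
      if "i \<in> {1..j}" for i
      using \<Phi> \<open>1 \<le> m\<close> \<open>j \<le> p\<close> that by (auto simp: replicate_map_def)
    have "(\<lambda>z. sup_on T p i (\<Phi> m (fst z) (fst (snd z)))) \<in> borel_measurable (?S m)"
      "(\<lambda>z. sup_on T p i (\<Phi> m (fst z) (snd (snd z)))) \<in> borel_measurable (?S m)" if "i \<in> {1..j}" for i
      using measurable_compose[OF _ \<Phi>m[OF that], of "\<lambda>z. (fst z, fst (snd z))" "?S m"]
        measurable_compose[OF _ \<Phi>m[OF that], of "\<lambda>z. (fst z, snd (snd z))" "?S m"] by simp_all
    then show "A1 m \<in> sets (?S m)" "A2 m \<in> sets (?S m)"
      unfolding A1_def A2_def by (intro sets.sets_Collect_finite_All borel_measurable_le; simp)+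
  qed
  \<comment> \<open>Kept generic in the model: with \<open>M\<close> it rewrites \<open>lim1\<close>
    and \<open>lim2\<close> in terms of \<open>\<mu>\<close>, with \<open>N\<close> it yields the
    hypotheses of \<open>average_whp\<close>.\<close>
  have prob:
    "\<P>(\<omega> in K m. \<forall>i\<in>{1..j}. sup_on T p i (replicate_fun \<Phi> m (\<lambda>k. Z m k \<omega>) (Q m b \<omega>)) \<le> x i) = measure (\<mu> m) (A1 m)"
    "b \<noteq> b' \<Longrightarrow> \<P>(\<omega> in K m. (\<forall>i\<in>{1..j}. sup_on T p i (replicate_fun \<Phi> m (\<lambda>k. Z m k \<omega>) (Q m b \<omega>)) \<le> x i) \<and>
      (\<forall>i\<in>{1..j}. sup_on T p i (replicate_fun \<Phi> m (\<lambda>k. Z m k \<omega>) (Q m b' \<omega>)) \<le> x i)) = measure (\<mu> m) (A1 m \<inter> A2 m)"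
    if "1 \<le> m" "1 \<le> b" "1 \<le> b'" and K: "sampling_model T R K Z Q"
      and eq: "stretch_law (K m) (Z m) m = stretch_law (M m) (X m) m"
    for m b b' and K :: "nat \<Rightarrow> 'k measure" and Z :: "nat \<Rightarrow> nat \<Rightarrow> 'k \<Rightarrow> 'v" and Q
  proof -
    have W: "(\<lambda>\<omega>. (restrict (\<lambda>i. Z m i \<omega>) {1..m}, Q m b \<omega>, Q m b' \<omega>)) \<in> K m \<rightarrow>\<^sub>M ?S m"
      if "1 \<le> b" "1 \<le> b'" for b b'
      using le_horizon[OF \<open>0 < T\<close>, of m] \<open>1 \<le> m\<close> that
      by (intro measurable_Pair sampling_modelD(6)[OF K] sampling_modelD(4)[OF K]) auto
    have C: "measure (\<mu> m) C = measure (K m) ((\<lambda>\<omega>. (restrict (\<lambda>i. Z m i \<omega>) {1..m}, Q m b \<omega>, Q m b' \<omega>)) -` C \<inter> space (K m))"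
      if "C \<in> sets (?S m)" "1 \<le> b" "1 \<le> b'" "b \<noteq> b'" for C b b'
      unfolding \<mu>_def eq[symmetric] replicate_pair_law[OF \<open>0 < T\<close> K \<open>1 \<le> m\<close> that(2-4), symmetric]
      using W that by (intro measure_distr) auto
    \<comment> \<open>A single replicate \<open>b\<close> is completed to a pair by
      \<open>Suc b\<close>, so that the law of pairs applies.\<close>
    show "\<P>(\<omega> in K m. \<forall>i\<in>{1..j}. sup_on T p i (replicate_fun \<Phi> m (\<lambda>k. Z m k \<omega>) (Q m b \<omega>)) \<le> x i) = measure (\<mu> m) (A1 m)"
      using C[OF A(1)[OF \<open>1 \<le> m\<close>], of b "Suc b"] \<open>1 \<le> b\<close> measurable_space[OF W[of b "Suc b"]]
      by (auto simp: A1_def replicate_fun_def intro!: arg_cong[of _ _ "measure _"])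
    show "\<P>(\<omega> in K m. (\<forall>i\<in>{1..j}. sup_on T p i (replicate_fun \<Phi> m (\<lambda>k. Z m k \<omega>) (Q m b \<omega>)) \<le> x i) \<and>
      (\<forall>i\<in>{1..j}. sup_on T p i (replicate_fun \<Phi> m (\<lambda>k. Z m k \<omega>) (Q m b' \<omega>)) \<le> x i)) = measure (\<mu> m) (A1 m \<inter> A2 m)"
      if "b \<noteq> b'"
      using C[OF sets.Int[OF A[OF \<open>1 \<le> m\<close>]], of b b'] \<open>1 \<le> b\<close> \<open>1 \<le> b'\<close> that measurable_space[OF W[of b b']]
      by (auto simp: A1_def A2_def replicate_fun_def intro!: arg_cong[of _ _ "measure _"])
  qed
  have "(\<lambda>m. measure (\<mu> m) (A1 m)) \<longlonglongrightarrow> c" "(\<lambda>m. measure (\<mu> m) (A1 m \<inter> A2 m)) \<longlonglongrightarrow> c\<^sup>2"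
    using prob[OF _ _ _ model, of _ 1 2]
    by (auto intro!: Lim_transform_eventually[OF lim1] Lim_transform_eventually[OF lim2] eventually_sequentiallyI[of 1])
  then show ?thesis
    unfolding joint_edf_def
  proof (intro average_whp)
    show "prob_space (N m)" if "1 \<le> m" for m
      by (rule sampling_modelD(1)[OF model' that])
    show "{\<omega> \<in> space (N m). \<forall>i\<in>{1..j}. sup_on T p i (replicate_fun \<Phi> m (\<lambda>k. Y m k \<omega>) (V m b \<omega>)) \<le> x i} \<in> sets (N m)"
      if "1 \<le> m" "1 \<le> b" for m b
      using that \<open>j \<le> p\<close>
      by (intro sets.sets_Collect_finite_All borel_measurable_le sup_on_replicate_measurable[OF \<open>0 < T\<close> \<Phi> model']) auto
  qed (use prob[OF _ _ _ model' law] \<open>0 < \<eta>\<close> in auto)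
qed

section \<open>Asymptotic level and power\<close>

theorem theorem3p3:
  fixes T \<alpha> :: real and p :: nat
    and S :: "'s measure" and Z :: "nat \<Rightarrow> 's \<Rightarrow> real ^ 'd" and F :: "real ^ 'd \<Rightarrow> real"
    and \<delta> :: "nat \<Rightarrow> nat \<Rightarrow> (nat \<Rightarrow> real ^ 'd) \<Rightarrow> real"
    and R :: "nat \<Rightarrow> 'w measure"
    and \<Phi> :: "nat \<Rightarrow> (nat \<Rightarrow> real ^ 'd) \<Rightarrow> 'w \<Rightarrow> real \<Rightarrow> real"
    and M :: "nat \<Rightarrow> 'a measure"
    and X :: "nat \<Rightarrow> nat \<Rightarrow> 'a \<Rightarrow> real ^ 'd" and W :: "nat \<Rightarrow> nat \<Rightarrow> 'a \<Rightarrow> 'w"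
    and L :: "'c measure" and DF :: "nat \<Rightarrow> 'c \<Rightarrow> real \<Rightarrow> real"
  assumes "0 < T" and "0 < \<alpha>" and "\<alpha> < 1 / 2" and "1 \<le> p"
    and series: "stationary_series S Z"
    and contemporary_df: "\<And>x. F x = \<P>(\<omega> in S. Z 1 \<omega> \<le> x)"
    and continuous_df: "continuous_on UNIV F"
    and detectors: "detector_statistics T \<delta>"
    and replicates: "replicate_map T p R \<Phi>"
    and model: "sampling_model T R M X W"
    and H0: "\<And>m. 1 \<le> m \<Longrightarrow>
      stretch_law (M m) (X m) (horizon T m) = stretch_law S Z (horizon T m)"
    and limit_space: "prob_space L"
    and independent: "prob_space.indep_vars L
      (\<lambda>_. borel_of (mtopology_of (linf {1..T + 1}))) DF {0, 1, 2}"
    and copies: "\<And>k. k \<in> {1, 2} \<Longrightarrow>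
      distr L (borel_of (mtopology_of (linf {1..T + 1}))) (DF k) =
      distr L (borel_of (mtopology_of (linf {1..T + 1}))) (DF 0)"
    and weak_convergence: "weakly_converges
      (prod_topology (mtopology_of (linf {1..T + 1}))
        (prod_topology (mtopology_of (linf {1..T + 1})) (mtopology_of (linf {1..T + 1}))))
      M (\<lambda>m \<omega>. (detector_fun T \<delta> m (\<lambda>i. X m i \<omega>),
                replicate_fun \<Phi> m (\<lambda>i. X m i \<omega>) (W m 1 \<omega>),
                replicate_fun \<Phi> m (\<lambda>i. X m i \<omega>) (W m 2 \<omega>)))
      L (\<lambda>\<omega>. (DF 0 \<omega>, DF 1 \<omega>, DF 2 \<omega>))"
    and continuous_limit_df: "continuous_map (powertop_real {1..p}) euclideanreal
      (\<lambda>x. \<P>(\<omega> in L. \<forall>i\<in>{1..p}. sup_on T p i (DF 0 \<omega>) \<le> x i))"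
  shows
    "((\<lambda>(m, B). \<P>(\<omega> in M m.
          below_threshold T p \<alpha> \<delta> \<Phi> m B (\<lambda>i. X m i \<omega>) (\<lambda>b. W m b \<omega>) 1))
        \<longlongrightarrow> (1 - \<alpha>) powr (1 / real p)) (sequentially \<times>\<^sub>F sequentially) \<and>
     (\<forall>i\<in>{2..p}.
       ((\<lambda>(m, B). \<P>(\<omega> in M m.
          below_threshold T p \<alpha> \<delta> \<Phi> m B (\<lambda>i. X m i \<omega>) (\<lambda>b. W m b \<omega>) i \<bar>
          (\<forall>j\<in>{1..i - 1}.
             below_threshold T p \<alpha> \<delta> \<Phi> m B (\<lambda>i. X m i \<omega>) (\<lambda>b. W m b \<omega>) j)))
        \<longlongrightarrow> (1 - \<alpha>) powr (1 / real p)) (sequentially \<times>\<^sub>F sequentially)) \<and>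
     ((\<lambda>(m, B). \<P>(\<omega> in M m. \<forall>t\<in>{1..T + 1}.
          ereal (detector_fun T \<delta> m (\<lambda>i. X m i \<omega>) t) \<le>
          threshold_fun T p \<alpha> \<Phi> m B (\<lambda>i. X m i \<omega>) (\<lambda>b. W m b \<omega>) t))
        \<longlongrightarrow> 1 - \<alpha>) (sequentially \<times>\<^sub>F sequentially) \<and>
     (\<forall>(N :: nat \<Rightarrow> 'b measure) Y V.
       sampling_model T R N Y V \<longrightarrow>
       (\<forall>m\<ge>1. stretch_law (N m) (Y m) m = stretch_law S Z m) \<longrightarrow>
       (\<forall>K. (\<lambda>m. \<P>(\<omega> in N m.
          K < (SUP t\<in>{1..T + 1}. detector_fun T \<delta> m (\<lambda>i. Y m i \<omega>) t))) \<longlonglongrightarrow> 1) \<longrightarrow>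
       ((\<lambda>(m, B). \<P>(\<omega> in N m. \<exists>t\<in>{1..T + 1}.
          ereal (detector_fun T \<delta> m (\<lambda>i. Y m i \<omega>) t) >
          threshold_fun T p \<alpha> \<Phi> m B (\<lambda>i. Y m i \<omega>) (\<lambda>b. V m b \<omega>) t))
        \<longlongrightarrow> 1) (sequentially \<times>\<^sub>F sequentially))"
proof -
  let ?linf = "mtopology_of (linf {1..T + 1})"
  define q where "q = (1 - \<alpha>) powr (1 / real p)"
  have q: "0 < q" "q < 1" "q ^ p = 1 - \<alpha>"
  proof -
    show "0 < q"
      using \<open>\<alpha> < 1 / 2\<close> by (simp add: q_def)
    show "q < 1"
      using \<open>0 < \<alpha>\<close> \<open>\<alpha> < 1 / 2\<close> \<open>1 \<le> p\<close> powr_less_mono2[of "1 / real p" "1 - \<alpha>" 1] by (simp add: q_def)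
    have "q ^ p = q powr real p"
      using \<open>0 < q\<close> by (simp add: powr_realpow)
    then show "q ^ p = 1 - \<alpha>"
      using \<open>1 \<le> p\<close> \<open>\<alpha> < 1 / 2\<close> by (simp add: q_def powr_powr)
  qed

  \<comment> \<open>The limiting suprema: laws, absence of atoms, independence of the copies\<close>
  interpret L: prob_space L
    by (rule limit_space)
  define U where "U k i \<omega> = sup_on T p i (DF k \<omega>)" for k i \<omega>
  define G where "G j x = \<P>(\<omega> in L. \<forall>i\<in>{1..j}. U 0 i \<omega> \<le> x i)" for j x
  have sup_measurable: "sup_on T p i \<in> borel_measurable (borel_of ?linf)" if "i \<in> {1..p}" for i
    by (rule continuous_map_measurable_borel_of[OF continuous_map_sup_on[OF \<open>0 < T\<close> that]])
  have DF: "DF k \<in> L \<rightarrow>\<^sub>M borel_of ?linf" if "k \<in> {0, 1, 2}" for k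
    using independent that unfolding L.indep_vars_def by blast
  have U: "U k i \<in> borel_measurable L" if "k \<in> {0, 1, 2}" "i \<in> {1..p}" for k i
    unfolding U_def[abs_def] by (rule measurable_compose[OF DF[OF that(1)] sup_measurable[OF that(2)]])
  have same_law: "L.prob (DF k -` C \<inter> space L) = L.prob (DF 0 -` C \<inter> space L)"
    if "k \<in> {0, 1, 2}" "C \<in> sets (borel_of ?linf)" for k C
  proof (cases "k = 0")
    case False
    then show ?thesis
      using measure_distr[OF DF[OF that(1)] that(2)] measure_distr[OF DF[of 0] that(2)] copies[of k] that(1)
      by auto
  qed simp
  \<comment> \<open>Continuity is assumed for \<open>DF 0\<close> only; the copies inherit the
    absence of atoms through equality of laws.\<close>
  have atomless: "\<P>(\<omega> in L. U k i \<omega> = c) = 0" if "k \<in> {0, 1, 2}" "i \<in> {1..p}" for k i c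
  proof -
    let ?C = "{f \<in> space (borel_of ?linf). sup_on T p i f = c}"
    have C: "?C \<in> sets (borel_of ?linf)"
      using sup_measurable[OF that(2)] by measurable
    have eq: "{\<omega> \<in> space L. U k' i \<omega> = c} = DF k' -` ?C \<inter> space L" if "k' \<in> {0, 1, 2}" for k'
      using measurable_space[OF DF[OF that]] by (auto simp: U_def)
    have "\<P>(\<omega> in L. U 0 i \<omega> = c) = 0"
      using L.atomless_of_continuous_joint_df[of "{1..p}" "U 0" i c] U[of 0] that(2) continuous_limit_df
      by (simp add: U_def)
    then show ?thesis
      using same_law[OF that(1) C] eq[OF that(1)] eq[of 0] by simp
  qed
  \<comment> \<open>Independence of the two copies produces the square, the value
    \<open>c\<^sup>2\<close> that the second moment argument requires.\<close>
  have box: "\<P>(\<omega> in L. \<forall>i\<in>{1..j}. U 1 i \<omega> \<le> x i) = G j x"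
    "\<P>(\<omega> in L. (\<forall>i\<in>{1..j}. U 1 i \<omega> \<le> x i) \<and> (\<forall>i\<in>{1..j}. U 2 i \<omega> \<le> x i)) = (G j x)\<^sup>2"
    if "j \<le> p" for j x
  proof -
    let ?C = "{f \<in> space (borel_of ?linf). \<forall>i\<in>{1..j}. sup_on T p i f \<le> x i}"
    have C: "?C \<in> sets (borel_of ?linf)"
      using sup_measurable that by (intro sets.sets_Collect_finite_All borel_measurable_le) auto
    have eq: "{\<omega> \<in> space L. \<forall>i\<in>{1..j}. U k i \<omega> \<le> x i} = DF k -` ?C \<inter> space L" if "k \<in> {0, 1, 2}" for k
      using measurable_space[OF DF[OF that]] by (auto simp: U_def)
    have k: "L.prob (DF k -` ?C \<inter> space L) = G j x" if "k \<in> {0, 1, 2}" for k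
      unfolding G_def using same_law[OF that C] eq[of 0] by simp
    show "\<P>(\<omega> in L. \<forall>i\<in>{1..j}. U 1 i \<omega> \<le> x i) = G j x"
      using eq[of 1] k[of 1] by simp
    have "{\<omega> \<in> space L. (\<forall>i\<in>{1..j}. U 1 i \<omega> \<le> x i) \<and> (\<forall>i\<in>{1..j}. U 2 i \<omega> \<le> x i)} =
        (\<Inter>k\<in>{1, 2}. DF k -` ?C \<inter> space L)"
      using eq[of 1] eq[of 2] by auto
    moreover have "L.prob (\<Inter>k\<in>{1, 2}. DF k -` ?C \<inter> space L) = (\<Prod>k\<in>{1, 2}. L.prob (DF k -` ?C \<inter> space L))"
      using C by (intro L.indep_varsD[OF independent]) auto
    ultimately show "\<P>(\<omega> in L. (\<forall>i\<in>{1..j}. U 1 i \<omega> \<le> x i) \<and> (\<forall>i\<in>{1..j}. U 2 i \<omega> \<le> x i)) = (G j x)\<^sup>2"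
      using k[of 1] k[of 2] by (simp add: power2_eq_square)
  qed

  \<comment> \<open>Convergence of the suprema of the detector and of two replicates\<close>
  define v where "v m i \<omega> = sup_on T p i (detector_fun T \<delta> m (\<lambda>k. X m k \<omega>))" for m i \<omega>
  define r where "r m b i \<omega> = sup_on T p i (replicate_fun \<Phi> m (\<lambda>k. X m k \<omega>) (W m b \<omega>))" for m b i \<omega>
  have M: "prob_space (M m)" if "1 \<le> m" for m
    by (rule sampling_modelD(1)[OF model that])
  have v: "v m i \<in> borel_measurable (M m)" if "1 \<le> m" "i \<in> {1..p}" for m i
    unfolding v_def[abs_def] by (rule sup_on_detector_measurable[OF \<open>0 < T\<close> detectors model that])
  have r: "r m b i \<in> borel_measurable (M m)" if "1 \<le> m" "1 \<le> b" "i \<in> {1..p}" for m b i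
    unfolding r_def[abs_def] by (rule sup_on_replicate_measurable[OF \<open>0 < T\<close> replicates model that])
  \<comment> \<open>The label \<open>k\<close> is 0 for the detector and otherwise the number of the
    replicate, so one statement covers every selection of components.\<close>
  define coord where "coord k i = (\<lambda>(f0, f1, f2). sup_on T p i (if k = (0::nat) then f0 else if k = 1 then f1 else f2))" for k i
  have coord_cont: "continuous_map (prod_topology ?linf (prod_topology ?linf ?linf)) euclideanreal (coord k i)"
    if "i \<in> {1..p}" for k i
  proof -
    note cs = continuous_map_sup_on[OF \<open>0 < T\<close> that]
    have "coord k i = (\<lambda>z. sup_on T p i (if k = 0 then fst z else if k = 1 then fst (snd z) else snd (snd z)))"
      by (auto simp: coord_def fun_eq_iff)
    moreover have "continuous_map (prod_topology ?linf (prod_topology ?linf ?linf)) ?linf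
        (\<lambda>z. if k = 0 then fst z else if k = 1 then fst (snd z) else snd (snd z))"
      by (cases "k = 0"; cases "k = 1")
         (auto intro: continuous_map_fst continuous_map_snd
            continuous_map_compose[OF continuous_map_snd continuous_map_fst, unfolded comp_def]
            continuous_map_compose[OF continuous_map_snd continuous_map_snd, unfolded comp_def])
    ultimately show ?thesis
      by (simp only: continuous_map_compose[OF _ cs, unfolded comp_def])
  qed
  \<comment> \<open>\<open>A\<close> selects the constrained components. It is used with
    \<open>{0}\<close> for the detector, \<open>{1}\<close> for one replicate and
    \<open>{1, 2}\<close> for a pair.\<close>
  have conv: "(\<lambda>m. \<P>(\<omega> in M m. \<forall>(k, i)\<in>A \<times> {1..j}. (if k = 0 then v m i \<omega> else r m k i \<omega>) \<le> x i))
      \<longlonglongrightarrow> \<P>(\<omega> in L. \<forall>(k, i)\<in>A \<times> {1..j}. U k i \<omega> \<le> x i)"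
    if "A \<subseteq> {0, 1, 2}" "j \<le> p" for A j x
  proof -
    have V: "coord k i (detector_fun T \<delta> m (\<lambda>i. X m i \<omega>),
          replicate_fun \<Phi> m (\<lambda>i. X m i \<omega>) (W m 1 \<omega>), replicate_fun \<Phi> m (\<lambda>i. X m i \<omega>) (W m 2 \<omega>)) =
        (if k = 0 then v m i \<omega> else r m k i \<omega>)"
      and Y: "coord k i (DF 0 \<omega>', DF 1 \<omega>', DF 2 \<omega>') = U k i \<omega>'"
      if "k \<in> {0, 1, 2}" for k i m \<omega> \<omega>'
      using that by (auto simp: coord_def v_def r_def U_def)
    have "finite A"
      using that(1) by (rule finite_subset) simp
    have "(\<lambda>m. \<P>(\<omega> in M m. \<forall>a\<in>A \<times> {1..j}. coord (fst a) (snd a) (detector_fun T \<delta> m (\<lambda>i. X m i \<omega>),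
          replicate_fun \<Phi> m (\<lambda>i. X m i \<omega>) (W m 1 \<omega>), replicate_fun \<Phi> m (\<lambda>i. X m i \<omega>) (W m 2 \<omega>)) \<le> x (snd a)))
        \<longlonglongrightarrow> \<P>(\<omega> in L. \<forall>a\<in>A \<times> {1..j}. coord (fst a) (snd a) (DF 0 \<omega>, DF 1 \<omega>, DF 2 \<omega>) \<le> x (snd a))"
    proof (rule weakly_converges_box[OF weak_convergence limit_space M])
      fix a m assume a: "a \<in> A \<times> {1..j}"
      then have a': "fst a \<in> {0, 1, 2}" "snd a \<in> {1..p}"
        using that by auto
      show "continuous_map (prod_topology ?linf (prod_topology ?linf ?linf)) euclideanreal (coord (fst a) (snd a))"
        by (rule coord_cont[OF a'(2)])
      show "\<P>(\<omega> in L. coord (fst a) (snd a) (DF 0 \<omega>, DF 1 \<omega>, DF 2 \<omega>) = x (snd a)) = 0"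
        using atomless[OF a'] by (simp only: Y[OF a'(1)])
      show "(\<lambda>\<omega>. coord (fst a) (snd a) (detector_fun T \<delta> m (\<lambda>i. X m i \<omega>),
          replicate_fun \<Phi> m (\<lambda>i. X m i \<omega>) (W m 1 \<omega>), replicate_fun \<Phi> m (\<lambda>i. X m i \<omega>) (W m 2 \<omega>)))
        \<in> borel_measurable (M m)" if "1 \<le> m"
        unfolding V[OF a'(1)] using v[OF that a'(2)] r[OF that _ a'(2), of "fst a"] a'(1) by auto
    qed (use \<open>finite A\<close> in auto)
    moreover have "(\<forall>a\<in>A \<times> {1..j}. coord (fst a) (snd a) (detector_fun T \<delta> m (\<lambda>i. X m i \<omega>),
          replicate_fun \<Phi> m (\<lambda>i. X m i \<omega>) (W m 1 \<omega>), replicate_fun \<Phi> m (\<lambda>i. X m i \<omega>) (W m 2 \<omega>)) \<le> x (snd a)) \<longleftrightarrow>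
        (\<forall>(k, i)\<in>A \<times> {1..j}. (if k = 0 then v m i \<omega> else r m k i \<omega>) \<le> x i)" for m \<omega>
      using that(1) V by (auto simp: subset_eq)
    moreover have "(\<forall>a\<in>A \<times> {1..j}. coord (fst a) (snd a) (DF 0 \<omega>, DF 1 \<omega>, DF 2 \<omega>) \<le> x (snd a)) \<longleftrightarrow>
        (\<forall>(k, i)\<in>A \<times> {1..j}. U k i \<omega> \<le> x i)" for \<omega>
      using that(1) Y by (auto simp: subset_eq)
    ultimately show ?thesis
      by simp
  qed
  have lim_v: "(\<lambda>m. \<P>(\<omega> in M m. \<forall>i\<in>{1..j}. v m i \<omega> \<le> x i)) \<longlonglongrightarrow> G j x"
    and lim1: "(\<lambda>m. \<P>(\<omega> in M m. \<forall>i\<in>{1..j}. r m 1 i \<omega> \<le> x i)) \<longlonglongrightarrow> G j x"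
    and lim2: "(\<lambda>m. \<P>(\<omega> in M m. (\<forall>i\<in>{1..j}. r m 1 i \<omega> \<le> x i) \<and> (\<forall>i\<in>{1..j}. r m 2 i \<omega> \<le> x i))) \<longlonglongrightarrow> (G j x)\<^sup>2"
    if "j \<le> p" for j x
  proof -
    have "(\<forall>(k, i)\<in>{a} \<times> {1..j}. P k i) \<longleftrightarrow> (\<forall>i\<in>{1..j}. P a i)"
      "(\<forall>(k, i)\<in>{1, 2} \<times> {1..j}. P k i) \<longleftrightarrow> (\<forall>i\<in>{1..j}. P 1 i) \<and> (\<forall>i\<in>{1..j}. P 2 i)"
      for a :: nat and P :: "nat \<Rightarrow> nat \<Rightarrow> bool"
      by auto
    note expand = this
    show "(\<lambda>m. \<P>(\<omega> in M m. \<forall>i\<in>{1..j}. v m i \<omega> \<le> x i)) \<longlonglongrightarrow> G j x"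
      using conv[of "{0}" j x] that by (simp add: expand G_def)
    show "(\<lambda>m. \<P>(\<omega> in M m. \<forall>i\<in>{1..j}. r m 1 i \<omega> \<le> x i)) \<longlonglongrightarrow> G j x"
      using conv[of "{1}" j x] that box(1)[OF that, of x] by (simp add: expand)
    show "(\<lambda>m. \<P>(\<omega> in M m. (\<forall>i\<in>{1..j}. r m 1 i \<omega> \<le> x i) \<and> (\<forall>i\<in>{1..j}. r m 2 i \<omega> \<le> x i))) \<longlonglongrightarrow> (G j x)\<^sup>2"
      using conv[of "{1, 2}" j x] that box(2)[OF that, of x] by (simp add: expand)
  qed

  \<comment> \<open>Deterministic brackets for the thresholds\<close>
  have law: "stretch_law (M m) (X m) m = stretch_law S Z m" if "1 \<le> m" for m
    by (rule stretch_law_cong[OF \<open>0 < T\<close> model that series H0[OF that]])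
  \<comment> \<open>Stated for every model with the right law of the learning sample, since it
    serves both \<open>M\<close> for the level and \<open>N\<close> for the power.\<close>
  have thresholds: "\<exists>l u. (\<forall>i. l i \<le> u i) \<and> G j u - G j l < e \<and> G j l \<le> q ^ j \<and> q ^ j \<le> G j u \<and>
      whp N (\<lambda>m B \<omega>. \<forall>i\<in>{1..j}. ereal (l i) \<le> threshold T p \<alpha> \<Phi> m B (\<lambda>k. Y m k \<omega>) (\<lambda>b. V m b \<omega>) i \<and>
        threshold T p \<alpha> \<Phi> m B (\<lambda>k. Y m k \<omega>) (\<lambda>b. V m b \<omega>) i \<le> ereal (u i))"
    if "sampling_model T R N Y V" "\<And>m. 1 \<le> m \<Longrightarrow> stretch_law (N m) (Y m) m = stretch_law S Z m" "j \<le> p" "0 < e"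
    for N :: "nat \<Rightarrow> 'x measure" and Y V j e
    unfolding threshold_def q_def[symmetric] G_def
  proof (rule L.thresholds_whp)
    fix k x and \<eta> :: real assume "k \<le> p" "0 < \<eta>"
    show "whp N (\<lambda>m B \<omega>. \<bar>joint_edf (\<lambda>b i. sup_on T p i (replicate_fun \<Phi> m (\<lambda>k. Y m k \<omega>) (V m b \<omega>))) B k x -
        \<P>(\<omega> in L. \<forall>i\<in>{1..k}. U 0 i \<omega> \<le> x i)\<bar> < \<eta>)"
      using lim1[OF \<open>k \<le> p\<close>, of x] lim2[OF \<open>k \<le> p\<close>, of x] law that(2) \<open>k \<le> p\<close> \<open>0 < \<eta>\<close>
      unfolding r_def G_def
      by (intro joint_edf_replicates_whp[OF \<open>0 < T\<close> replicates model that(1)]) auto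
  qed (use U[of 0] atomless[of 0] q that sampling_modelD(1)[OF that(1)] in auto)

  \<comment> \<open>Asymptotic level under the null hypothesis\<close>
  define below where "below m B \<omega> = below_threshold T p \<alpha> \<delta> \<Phi> m B (\<lambda>i. X m i \<omega>) (\<lambda>b. W m b \<omega>)" for m B \<omega>
  have joint: "((\<lambda>(m, B). \<P>(\<omega> in M m. \<forall>i\<in>{1..j}. below m B \<omega> i)) \<longlongrightarrow> q ^ j) (sequentially \<times>\<^sub>F sequentially)"
    if "j \<le> p" for j
  proof (rule tendsto_sandwich_whp)
    show "prob_space (M m)" if "1 \<le> m" for m
      by (rule M[OF that])
    show "{\<omega> \<in> space (M m). \<forall>i\<in>{1..j}. below m B \<omega> i} \<in> sets (M m)" if "1 \<le> m" for m B
      using \<open>j \<le> p\<close> unfolding below_def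
      by (intro sets.sets_Collect_finite_All below_threshold_measurable[OF \<open>0 < T\<close> detectors replicates model that]) auto
    fix e :: real assume "0 < e"
    from thresholds[OF model law that this] obtain l u where
      lu: "G j u - G j l < e" "G j l \<le> q ^ j" "q ^ j \<le> G j u" and
      whp: "whp M (\<lambda>m B \<omega>. \<forall>i\<in>{1..j}. ereal (l i) \<le> threshold T p \<alpha> \<Phi> m B (\<lambda>k. X m k \<omega>) (\<lambda>b. W m b \<omega>) i \<and>
        threshold T p \<alpha> \<Phi> m B (\<lambda>k. X m k \<omega>) (\<lambda>b. W m b \<omega>) i \<le> ereal (u i))"
      by auto
    have meas: "{\<omega> \<in> space (M m). \<forall>i\<in>{1..j}. v m i \<omega> \<le> x i} \<in> sets (M m)" if "1 \<le> m" for m x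
      using v[OF that] \<open>j \<le> p\<close> by (intro sets.sets_Collect_finite_All borel_measurable_le) auto
    have "whp M (\<lambda>m B \<omega>. ((\<forall>i\<in>{1..j}. v m i \<omega> \<le> l i) \<longrightarrow> (\<forall>i\<in>{1..j}. below m B \<omega> i)) \<and>
        ((\<forall>i\<in>{1..j}. below m B \<omega> i) \<longrightarrow> (\<forall>i\<in>{1..j}. v m i \<omega> \<le> u i)))"
      using whp
    proof (rule whp_mono, intro conjI impI ballI)
      fix m B \<omega> i
      assume *: "\<forall>i\<in>{1..j}. ereal (l i) \<le> threshold T p \<alpha> \<Phi> m B (\<lambda>k. X m k \<omega>) (\<lambda>b. W m b \<omega>) i \<and>
        threshold T p \<alpha> \<Phi> m B (\<lambda>k. X m k \<omega>) (\<lambda>b. W m b \<omega>) i \<le> ereal (u i)" and i: "i \<in> {1..j}"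
      have below: "below m B \<omega> i \<longleftrightarrow> ereal (v m i \<omega>) \<le> threshold T p \<alpha> \<Phi> m B (\<lambda>k. X m k \<omega>) (\<lambda>b. W m b \<omega>) i"
        by (simp add: below_def below_threshold_def v_def)
      show "below m B \<omega> i" if "\<forall>i\<in>{1..j}. v m i \<omega> \<le> l i"
      proof -
        have "ereal (v m i \<omega>) \<le> ereal (l i)"
          using that i by simp
        also have "\<dots> \<le> threshold T p \<alpha> \<Phi> m B (\<lambda>k. X m k \<omega>) (\<lambda>b. W m b \<omega>) i"
          using * i by blast
        finally show ?thesis
          using below by blast
      qed
      show "v m i \<omega> \<le> u i" if "\<forall>i\<in>{1..j}. below m B \<omega> i"
      proof -
        have "ereal (v m i \<omega>) \<le> threshold T p \<alpha> \<Phi> m B (\<lambda>k. X m k \<omega>) (\<lambda>b. W m b \<omega>) i"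
          using that i below by blast
        also have "\<dots> \<le> ereal (u i)"
          using * i by blast
        finally show ?thesis
          by simp
      qed
    qed
    \<comment> \<open>\<open>q ^ j\<close> lies between \<open>G j l\<close> and
      \<open>G j u\<close>, which differ by less than \<open>e\<close>, so both limits are within
      \<open>e\<close> of it.\<close>
    then show "\<exists>Lo Up a b.
      (\<forall>m\<ge>1. {\<omega> \<in> space (M m). Lo m \<omega>} \<in> sets (M m) \<and> {\<omega> \<in> space (M m). Up m \<omega>} \<in> sets (M m)) \<and>
      whp M (\<lambda>m B \<omega>. (Lo m \<omega> \<longrightarrow> (\<forall>i\<in>{1..j}. below m B \<omega> i)) \<and> ((\<forall>i\<in>{1..j}. below m B \<omega> i) \<longrightarrow> Up m \<omega>)) \<and>
      (\<lambda>m. \<P>(\<omega> in M m. Lo m \<omega>)) \<longlonglongrightarrow> a \<and> (\<lambda>m. \<P>(\<omega> in M m. Up m \<omega>)) \<longlonglongrightarrow> b \<and>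
      q ^ j - e < a \<and> b < q ^ j + e"
      using lim_v[OF that, of l] lim_v[OF that, of u] lu meas
      by (rule_tac exI[of _ "\<lambda>m \<omega>. \<forall>i\<in>{1..j}. v m i \<omega> \<le> l i"], rule_tac exI[of _ "\<lambda>m \<omega>. \<forall>i\<in>{1..j}. v m i \<omega> \<le> u i"],
        rule_tac exI[of _ "G j l"], rule_tac exI[of _ "G j u"]) (intro conjI allI impI; (assumption | linarith | erule meas))
  qed
  have first: "((\<lambda>(m, B). \<P>(\<omega> in M m. below m B \<omega> 1)) \<longlongrightarrow> q) (sequentially \<times>\<^sub>F sequentially)"
    using joint[OF \<open>1 \<le> p\<close>] by simp
  \<comment> \<open>A conditional probability is a quotient of two probabilities from
    \<open>joint\<close>, and the limit \<open>q ^ (i - 1)\<close> of the denominator is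
    positive.\<close>
  have cond: "((\<lambda>(m, B). \<P>(\<omega> in M m. below m B \<omega> i \<bar> (\<forall>j\<in>{1..i - 1}. below m B \<omega> j))) \<longlongrightarrow> q)
      (sequentially \<times>\<^sub>F sequentially)" if i: "i \<in> {2..p}" for i
  proof -
    have "{1..i} = insert i {1..i - 1}"
      using i by auto
    then have eq: "(\<forall>j\<in>{1..i}. P j) \<longleftrightarrow> P i \<and> (\<forall>j\<in>{1..i - 1}. P j)" for P
      by simp
    have "((\<lambda>x. (case x of (m, B) \<Rightarrow> \<P>(\<omega> in M m. \<forall>j\<in>{1..i}. below m B \<omega> j)) /
        (case x of (m, B) \<Rightarrow> \<P>(\<omega> in M m. \<forall>j\<in>{1..i - 1}. below m B \<omega> j))) \<longlongrightarrow> q ^ i / q ^ (i - 1))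
        (sequentially \<times>\<^sub>F sequentially)"
      using i q by (intro tendsto_divide joint) auto
    moreover have "q ^ i / q ^ (i - 1) = q"
      using i q by (cases i) auto
    ultimately show ?thesis
      by (simp only: cond_prob_def case_prod_unfold eq)
  qed
  have all: "((\<lambda>(m, B). \<P>(\<omega> in M m. \<forall>t\<in>{1..T + 1}. ereal (detector_fun T \<delta> m (\<lambda>i. X m i \<omega>) t) \<le>
      threshold_fun T p \<alpha> \<Phi> m B (\<lambda>i. X m i \<omega>) (\<lambda>b. W m b \<omega>) t)) \<longlongrightarrow> 1 - \<alpha>) (sequentially \<times>\<^sub>F sequentially)"
    unfolding no_exceedance_iff[OF \<open>0 < T\<close> \<open>1 \<le> p\<close>] using joint[of p] q(3) by (simp add: below_def)

  \<comment> \<open>Asymptotic power under the alternative\<close>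
  have alternative: "((\<lambda>(m, B). \<P>(\<omega> in N m. \<exists>t\<in>{1..T + 1}. ereal (detector_fun T \<delta> m (\<lambda>i. Y m i \<omega>) t) >
      threshold_fun T p \<alpha> \<Phi> m B (\<lambda>i. Y m i \<omega>) (\<lambda>b. V m b \<omega>) t)) \<longlongrightarrow> 1) (sequentially \<times>\<^sub>F sequentially)"
    if model': "sampling_model T R N Y V"
      and law': "\<forall>m\<ge>1. stretch_law (N m) (Y m) m = stretch_law S Z m"
      and diverge: "\<forall>K. (\<lambda>m. \<P>(\<omega> in N m.
        K < (SUP t\<in>{1..T + 1}. detector_fun T \<delta> m (\<lambda>i. Y m i \<omega>) t))) \<longlonglongrightarrow> 1"
    for N :: "nat \<Rightarrow> 'b measure" and Y V
  proof -
    have N: "prob_space (N m)" if "1 \<le> m" for m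
      by (rule sampling_modelD(1)[OF model' that])
    define th where "th m B \<omega> i = threshold T p \<alpha> \<Phi> m B (\<lambda>k. Y m k \<omega>) (\<lambda>b. V m b \<omega>) i" for m B \<omega> i
    \<comment> \<open>The width 1 is arbitrary: what matters is that the upper bounds are constants
      in \<open>m\<close> and \<open>B\<close>.\<close>
    obtain l u where "whp N (\<lambda>m B \<omega>. \<forall>i\<in>{1..p}. ereal (l i) \<le> th m B \<omega> i \<and> th m B \<omega> i \<le> ereal (u i))"
      using thresholds[OF model', of p 1] law' by (auto simp: th_def)
    then have u: "whp N (\<lambda>m B \<omega>. \<forall>i\<in>{1..p}. th m B \<omega> i \<le> ereal (u i))"
      by (rule whp_mono) blast
    \<comment> \<open>Without an exceedance, the detector would stay below the largest of the bounds
      \<open>u i\<close>, a constant that its supremum exceeds with high probability.\<close>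
    define K where "K = Max (u ` {1..p})"
    have "whp N (\<lambda>m B \<omega>. K < (SUP t\<in>{1..T + 1}. detector_fun T \<delta> m (\<lambda>i. Y m i \<omega>) t))"
      using diverge by (intro whp_of_tendsto tendsto_fst_snd) auto
    with N u have "whp N (\<lambda>m B \<omega>. (\<forall>i\<in>{1..p}. th m B \<omega> i \<le> ereal (u i)) \<and>
        K < (SUP t\<in>{1..T + 1}. detector_fun T \<delta> m (\<lambda>i. Y m i \<omega>) t))"
      by (rule whp_conj)
    then have exceed: "whp N (\<lambda>m B \<omega>. \<not> (\<forall>i\<in>{1..p}. below_threshold T p \<alpha> \<delta> \<Phi> m B (\<lambda>i. Y m i \<omega>) (\<lambda>b. V m b \<omega>) i))"
    proof (rule whp_mono, intro notI)
      fix m B \<omega>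
      assume *: "(\<forall>i\<in>{1..p}. th m B \<omega> i \<le> ereal (u i)) \<and>
          K < (SUP t\<in>{1..T + 1}. detector_fun T \<delta> m (\<lambda>i. Y m i \<omega>) t)"
        and below: "\<forall>i\<in>{1..p}. below_threshold T p \<alpha> \<delta> \<Phi> m B (\<lambda>i. Y m i \<omega>) (\<lambda>b. V m b \<omega>) i"
      have "detector_fun T \<delta> m (\<lambda>i. Y m i \<omega>) t \<le> K" if t: "t \<in> {1..T + 1}" for t
      proof -
        obtain i where i: "i \<in> {1..p}" "t \<in> sub_interval T p i"
          using sub_interval_cover[OF \<open>0 < T\<close> \<open>1 \<le> p\<close> t] by blast
        have "ereal (sup_on T p i (detector_fun T \<delta> m (\<lambda>i. Y m i \<omega>))) \<le> th m B \<omega> i"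
          using below i(1) by (simp add: below_threshold_def th_def)
        also have "\<dots> \<le> ereal (u i)"
          using * i(1) by blast
        also have "\<dots> \<le> ereal K"
          using i(1) by (auto simp: K_def intro!: Max_ge)
        finally show ?thesis
          using sup_on_le_iff[OF \<open>0 < T\<close> i(1) bounded_detector_fun[of T \<delta> m "\<lambda>i. Y m i \<omega>"], of "ereal K"] i(2)
          by auto
      qed
      then have "(SUP t\<in>{1..T + 1}. detector_fun T \<delta> m (\<lambda>i. Y m i \<omega>) t) \<le> K"
        using \<open>0 < T\<close> by (intro cSUP_least) auto
      with * show False
        by linarith
    qed
    \<comment> \<open>With \<open>Lo\<close> and \<open>Up\<close> both constantly true, the
      sandwich lemma turns \<open>whp\<close> back into a limit of probabilities.\<close>
    have one: "(\<lambda>m. \<P>(\<omega> in N m. True)) \<longlonglongrightarrow> 1"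
      using prob_space.prob_space[OF N] by (intro tendsto_eventually eventually_sequentiallyI[of 1]) simp
    have "((\<lambda>(m, B). \<P>(\<omega> in N m. \<not> (\<forall>i\<in>{1..p}. below_threshold T p \<alpha> \<delta> \<Phi> m B (\<lambda>i. Y m i \<omega>) (\<lambda>b. V m b \<omega>) i)))
        \<longlongrightarrow> 1) (sequentially \<times>\<^sub>F sequentially)"
    proof (rule tendsto_sandwich_whp[OF N])
      show "{\<omega> \<in> space (N m). \<not> (\<forall>i\<in>{1..p}. below_threshold T p \<alpha> \<delta> \<Phi> m B (\<lambda>i. Y m i \<omega>) (\<lambda>b. V m b \<omega>) i)} \<in> sets (N m)"
        if "1 \<le> m" for m B
        by (intro sets.sets_Collect_neg sets.sets_Collect_finite_All
            below_threshold_measurable[OF \<open>0 < T\<close> detectors replicates model' that]) auto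
    qed (use exceed one in \<open>auto intro!: exI[of _ "\<lambda>_ _. True"] exI[of _ "1::real"]\<close>)
    then show ?thesis
      unfolding no_exceedance_iff[OF \<open>0 < T\<close> \<open>1 \<le> p\<close>, symmetric] by (simp add: not_le)
  qed
  show ?thesis
    using first cond all alternative unfolding q_def below_def by blast
qed

end
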